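(* For every $\tau\in[0,1]$ the function $\varphi_\tau(s)=(1-\tau)f_0(s)+\tau f_1(s)$ satisfies the functional equation $$\varphi_\tau(s)=W(s)\,\overline{\varphi_\tau(1-\bar s)},\qquad W(s)=5^{(1/2)-s}\,2(2\pi)^{s-1}\,\Gamma(1-s)\sin\frac{\pi s}{2},$$ as an identity of meromorphic functions on $\mathbb{C}$. Moreover, as $\tau$ varies from $0$ to $1$, $\varphi_\tau$ is a continuous deformation of $f_0$ into $f_1$, i.e. $\varphi_0=f_0$, $\varphi_1=f_1$, and for every compact set $K\subset\mathbb{C}\setminus\{1\}$ and every $\tau'\in[0,1]$ one has $\lim_{\tau\to\tau'}\varphi_\tau(s)=\varphi_{\tau'}(s)$ uniformly for $s\in K$.
   Context: $\zeta$ denotes the Riemann zeta function. The function $f_0$ is $f_0(s)=\left(1+\frac{\sqrt5}{5^s}\right)\zeta(s)$, meromorphic on $\mathbb{C}$ with its only pole at $s=1$; for $\operatorname{Re}s>1$ it is the sum of the Dirichlet series $1+\frac1{2^s}+\frac1{3^s}+\frac1{4^s}+\frac{1+\sqrt5}{5^s}+\cdots$ with coefficients periodic modulo $5$. The function $f_1$ is the analytic continuation to the whole complex plane of the Dirichlet series $1-\frac1{2^s}-\frac1{3^s}+\frac1{4^s}+\frac0{5^s}+\cdots$ whose coefficients are periodic modulo $5$ (the Dirichlet $L$-function of the real even primitive character modulo $5$). *)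

theory Defs
  imports "HOL-Complex_Analysis.Complex_Analysis"
begin

(* The continuation lives on the connected set C - {1}, so it is unique there;
   the value 0 at the pole is a convention that makes the description definite. *)
definition riemann_zeta :: "complex \<Rightarrow> complex" where
  "riemann_zeta = (THE f. f holomorphic_on (- {1}) \<and> f 1 = 0 \<and>
     (\<forall>s. Re s > 1 \<longrightarrow> (\<lambda>n. 1 / of_nat (Suc n) powr s) sums f s))"

definition chi5 :: "nat \<Rightarrow> complex" where
  "chi5 n = (if n mod 5 \<in> {1, 4} then 1 else if n mod 5 \<in> {2, 3} then - 1 else 0)"

definition f0 :: "complex \<Rightarrow> complex" where
  "f0 s = (1 + of_real (sqrt 5) / 5 powr s) * riemann_zeta s"

definition f1 :: "complex \<Rightarrow> complex" where
  "f1 = (THE f. f holomorphic_on UNIV \<and>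
     (\<forall>s. Re s > 1 \<longrightarrow> (\<lambda>n. chi5 (Suc n) / of_nat (Suc n) powr s) sums f s))"

definition phi :: "real \<Rightarrow> complex \<Rightarrow> complex" where
  "phi \<tau> s = of_real (1 - \<tau>) * f0 s + of_real \<tau> * f1 s"

definition W :: "complex \<Rightarrow> complex" where
  "W s = 5 powr (1 / 2 - s) * 2 * (2 * of_real pi) powr (s - 1) * Gamma (1 - s)
           * sin (of_real pi * s / 2)"

end

theory Submission
  imports Defs
begin

text \<open>
  Let \<open>a\<close> be real, even, periodic modulo \<open>q\<close> and equal to its own (normalised) discrete Fourier
  transform; this covers \<open>\<zeta>\<close> (\<open>q = 1\<close>, \<open>a = 1\<close>) and \<open>f1\<close> (\<open>q = 5\<close>, by the Gauss sum).
  Self-duality and the partial fraction expansion of the cotangent give, for \<open>x > 0\<close>,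
  \<open>\<Sum>n\<ge>1. a n * exp (- n x) = c / x - a 0 / 2 + (2 / \<surd>q) * \<Sum>n\<ge>1. a n * x / (x\<^sup>2 + (2 \<pi> n / q)\<^sup>2)\<close>
  with \<open>c = a 0 / \<surd>q\<close>. The Mellin transform of the left-hand side is \<open>\<Gamma>(s) L(s)\<close> for \<open>Re s > 1\<close>.
  Subtracting the two polar terms on \<open>(0, 1]\<close> continues it to \<open>Re s > -1\<close>, and for \<open>-1 < s < 0\<close> the
  continuation is the Mellin transform of the last sum, which integrated term by term is an
  elementary factor times \<open>L(1 - s)\<close>. Only absolutely convergent integrals occur. Hence the
  functional equation holds on a segment, it defines \<open>L\<close> for \<open>Re s < 0\<close>, and the identity theorem
  does the rest. For \<open>f0\<close> the factor \<open>1 + 5 powr (1/2 - s)\<close> turns the equation of \<open>\<zeta>\<close> into the one with \<open>W\<close>.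
\<close>

subsection \<open>Partial fractions of the cotangent\<close>

text \<open>Logarithmic derivative of the reflection formula. It is taken for \<open>rGamma\<close>,
  which is entire, so that only a product has to be differentiated.\<close>

lemma Digamma_reflection:
  fixes z :: complex
  assumes "z \<notin> \<int>"
  shows "Digamma (1 - z) - Digamma z = of_real pi * cot (of_real pi * z)"
proof -
  have z: "z \<notin> \<int>\<^sub>\<le>\<^sub>0" "1 - z \<notin> \<int>\<^sub>\<le>\<^sub>0"
    using assms nonpos_Ints_Int[of z] nonpos_Ints_Int[of "1 - z"] Ints_diff[OF Ints_1, of "1 - z"]
    by auto
  have sin_nz: "sin (of_real pi * z) \<noteq> 0"
    using assms by (auto simp: sin_eq_0 mult.commute)
  have prod: "rGamma w * rGamma (1 - w) = sin (of_real pi * w) / of_real pi" for w :: complex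
    by (rule rGamma_reflection_complex)
  have "((\<lambda>w. rGamma w * rGamma (1 - w)) has_field_derivative
          rGamma z * rGamma (1 - z) * (Digamma (1 - z) - Digamma z)) (at z)"
    using z by (auto intro!: derivative_eq_intros DERIV_chain2[OF has_field_derivative_rGamma_no_nonpos_int] simp: algebra_simps)
  moreover have "((\<lambda>w::complex. sin (of_real pi * w) / of_real pi) has_field_derivative
          cos (of_real pi * z)) (at z)"
    by (auto intro!: derivative_eq_intros)
  ultimately have "rGamma z * rGamma (1 - z) * (Digamma (1 - z) - Digamma z) = cos (of_real pi * z)"
    unfolding prod by (rule DERIV_unique)
  then show ?thesis
    using sin_nz unfolding prod by (simp add: cot_def field_simps)
qed

text \<open>In the difference of the limit formulas for \<open>Digamma (1 - z)\<close> and
  \<open>Digamma z\<close> the logarithms cancel. Grouping the pole at -n with the one at n + 1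
  keeps this conditionally convergent expansion a limit of explicit partial sums.\<close>

lemma cot_partial_fractions:
  fixes z :: complex
  assumes "z \<notin> \<int>"
  shows "(\<lambda>m. \<Sum>n<m. 1 / (z + of_nat n) + 1 / (z - of_nat (Suc n)))
           \<longlonglongrightarrow> of_real pi * cot (of_real pi * z)"
proof -
  have "z \<noteq> 0" "1 - z \<noteq> 0"
    using assms by auto
  from tendsto_diff[OF Digamma_LIMSEQ[OF this(2)] Digamma_LIMSEQ[OF this(1)]]
  have "(\<lambda>m. (\<Sum>n<m. inverse (z + of_nat n)) - (\<Sum>n<m. inverse (1 - z + of_nat n)))
          \<longlonglongrightarrow> Digamma (1 - z) - Digamma z"
    by simp
  moreover have "inverse (1 - z + of_nat n) = - (1 / (z - of_nat (Suc n)))" for n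
  proof -
    have "1 - z + of_nat n = - (z - of_nat (Suc n))" by simp
    then show ?thesis by (metis inverse_eq_divide inverse_minus_eq)
  qed
  ultimately show ?thesis
    unfolding Digamma_reflection[OF assms]
    by (simp add: sum.distrib sum_negf inverse_eq_divide)
qed

text \<open>The real part of 1 / (x + i y), that is, the Poisson kernel of the half-plane up to a
  constant.\<close>

definition poisson_term :: "real \<Rightarrow> real \<Rightarrow> real" where
  "poisson_term x y = x / (x\<^sup>2 + y\<^sup>2)"

lemma poisson_term_nonneg: "x \<ge> 0 \<Longrightarrow> poisson_term x y \<ge> 0"
  by (simp add: poisson_term_def)

text \<open>With w = 2 pi i u, the function 1 / (exp w - 1) + 1/2 is cot (pi u) / (2 i). Its partial
  fractions are 1 / (w + 2 pi i n) over all integers n, and their real parts are Poisson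
  terms.\<close>

lemma Re_inverse_exp_minus_1:
  fixes x \<theta> :: real
  assumes "x > 0"
  shows "(\<lambda>m. \<Sum>n<m. poisson_term x (2 * pi * real n - \<theta>) + poisson_term x (2 * pi * real (Suc n) + \<theta>))
           \<longlonglongrightarrow> Re (1 / (exp (Complex x (- \<theta>)) - 1)) + 1 / 2"
proof -
  define w where "w = Complex x (- \<theta>)"
  define u where "u = w / (2 * of_real pi * \<i>)"
  have wu: "w = 2 * of_real pi * \<i> * u" by (simp add: u_def)
  \<comment> \<open>\<open>Im u\<close> equals - x / (2 pi), so x > 0 keeps u away from the poles of
    the cotangent.\<close>
  have "Im u \<noteq> 0"
    using assms by (simp add: u_def w_def Im_divide power2_eq_square)
  then have u: "u \<notin> \<int>" by (auto elim!: Ints_cases)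
  then have sin_nz: "sin (of_real pi * u) \<noteq> 0"
    by (auto simp: sin_eq_0 mult.commute)
  define E where "E = exp (\<i> * (of_real pi * u))"
  have E: "E \<noteq> 0" "exp (- (\<i> * (of_real pi * u))) = inverse E"
    by (simp_all add: E_def exp_minus)
  have expw: "exp w = E\<^sup>2"
    unfolding E_def wu by (simp flip: exp_double add: mult_ac)
  have "E\<^sup>2 \<noteq> 1"
    using sin_nz E(1) unfolding sin_exp_eq E_def[symmetric] E(2) by (auto simp: field_simps power2_eq_square)
  then have "1 / (exp w - 1) + 1 / 2 = 1 / (2 * \<i>) * cot (of_real pi * u)"
    unfolding cot_def sin_exp_eq cos_exp_eq E_def[symmetric] E(2) expw using E(1)
    by (simp add: field_simps power2_eq_square)
  then have eq: "1 / (exp w - 1) + 1 / 2 = 1 / (2 * of_real pi * \<i>) * (of_real pi * cot (of_real pi * u))"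
    by simp
  have "(\<lambda>m. 1 / (2 * of_real pi * \<i>) * (\<Sum>n<m. 1 / (u + of_nat n) + 1 / (u - of_nat (Suc n))))
           \<longlonglongrightarrow> 1 / (exp w - 1) + 1 / 2"
    unfolding eq by (intro tendsto_mult tendsto_const cot_partial_fractions u)
  from tendsto_Re[OF this]
  have lim: "(\<lambda>m. \<Sum>n<m. Re (1 / (2 * of_real pi * \<i>) * (1 / (u + of_nat n) + 1 / (u - of_nat (Suc n)))))
           \<longlonglongrightarrow> Re (1 / (exp w - 1)) + 1 / 2"
    by (simp only: sum_distrib_left Re_sum plus_complex.sel Re_divide_numeral one_complex.sel)
  have R: "Re (1 / (2 * of_real pi * \<i>) * (1 / (u + of_real y))) = poisson_term x (2 * pi * y - \<theta>)" for y
  proof -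
    have "1 / (2 * of_real pi * \<i>) * (1 / (u + of_real y)) = 1 / (w + 2 * of_real pi * \<i> * of_real y)"
      by (simp add: wu algebra_simps)
    also have "w + 2 * of_real pi * \<i> * of_real y = Complex x (2 * pi * y - \<theta>)"
      by (simp add: w_def complex_eq_iff)
    finally show ?thesis by (simp add: poisson_term_def Re_divide)
  qed
  have "Re (1 / (2 * of_real pi * \<i>) * (1 / (u + of_nat n) + 1 / (u - of_nat (Suc n))))
     = poisson_term x (2 * pi * real n - \<theta>) + poisson_term x (2 * pi * real (Suc n) + \<theta>)" for n
  proof -
    \<comment> \<open>The negative indices are reflected by evenness of the kernel in its second
      argument.\<close>
    have "poisson_term x (2 * pi * (- real (Suc n)) - \<theta>) = poisson_term x (2 * pi * real (Suc n) + \<theta>)"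
      by (simp add: poisson_term_def power2_eq_square algebra_simps)
    moreover have "u - of_nat (Suc n) = u + of_real (- real (Suc n))" "u + of_nat n = u + of_real (real n)"
      by simp_all
    ultimately show ?thesis
      by (simp only: distrib_left plus_complex.sel R)
  qed
  with lim show ?thesis
    by (simp only: w_def)
qed

subsection \<open>Self-dual even periodic coefficients\<close>

text \<open>For an even sequence the sine part of the discrete Fourier transform vanishes, so the
  cosine sum is the whole transform, and \<open>self_dual\<close> says that it has eigenvalue
  \<open>sqrt q\<close>. Integer indices allow evenness to be stated directly.\<close>

locale self_dual_even =
  fixes q :: nat and a :: "int \<Rightarrow> real"
  assumes q_pos: "q > 0"
    and periodic: "a (j + int q) = a j"
    and even: "a (- j) = a j"
    and self_dual: "(\<Sum>k<q. a (int k) * cos (2 * pi * real k * real n / real q)) = sqrt (real q) * a (int n)"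
begin

lemma periodic_mult: "a (j + int q * m) = a j"
proof (induction m rule: int_induct[where k = 0])
  case (step1 i)
  then show ?case using periodic[of "j + int q * i"] by (simp add: algebra_simps)
next
  case (step2 i)
  then show ?case using periodic[of "j + int q * (i - 1)"] by (simp add: algebra_simps)
qed simp

definition bnd :: real where "bnd = (\<Sum>k<q. \<bar>a (int k)\<bar>)"

lemma bnd_nonneg: "bnd \<ge> 0"
  by (simp add: bnd_def sum_nonneg)

lemma abs_le_bnd: "\<bar>a j\<bar> \<le> bnd"
proof -
  have "a j = a (j mod int q)"
    using periodic_mult[of "j mod int q" "j div int q"] by simp
  also have "j mod int q = int (nat (j mod int q))"
    using q_pos by simp
  finally have "\<bar>a j\<bar> = \<bar>a (int (nat (j mod int q)))\<bar>" by simp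
  also have "\<dots> \<le> bnd"
    unfolding bnd_def using q_pos
    by (intro member_le_sum[where f = "\<lambda>k. \<bar>a (int k)\<bar>"]) (auto simp: nat_less_iff)
  finally show ?thesis .
qed

definition theta :: "real \<Rightarrow> real" where
  "theta x = (\<Sum>n. a (int (Suc n)) * exp (- (real (Suc n) * x)))"

definition cauchy_sum :: "real \<Rightarrow> real" where
  "cauchy_sum x = (\<Sum>n. a (int (Suc n)) * poisson_term x (2 * pi * real (Suc n) / real q))"

lemma summable_theta_abs:
  assumes "x > 0"
  shows "summable (\<lambda>n. \<bar>a (int (Suc n)) * exp (- (real (Suc n) * x))\<bar>)"
proof (rule summable_comparison_test', rule summable_mult)
  show "summable (\<lambda>n. exp (- x) ^ Suc n)"
    using assms by (subst summable_Suc_iff) (auto intro!: summable_geometric)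
  show "norm \<bar>a (int (Suc n)) * exp (- (real (Suc n) * x))\<bar> \<le> bnd * exp (- x) ^ Suc n" for n
  proof -
    have "exp (- x) ^ Suc n = exp (- (real (Suc n) * x))"
      unfolding exp_of_nat_mult[symmetric] by (simp add: algebra_simps)
    then show ?thesis using abs_le_bnd[of "int (Suc n)"]
      by (simp add: abs_mult mult_right_mono)
  qed
qed

lemma summable_cauchy_abs:
  assumes "x > 0"
  shows "summable (\<lambda>n. \<bar>a (int (Suc n)) * poisson_term x (2 * pi * real (Suc n) / real q)\<bar>)"
proof (rule summable_comparison_test', rule summable_mult)
  show "summable (\<lambda>n. 1 / real (Suc n) ^ 2)"
    using inverse_power_summable[of 2, where ?'a = real] by (subst summable_Suc_iff) (simp add: field_simps)
  show "norm \<bar>a (int (Suc n)) * poisson_term x (2 * pi * real (Suc n) / real q)\<bar>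
          \<le> (bnd * (x * (real q / (2 * pi))\<^sup>2)) * (1 / real (Suc n) ^ 2)" for n
  proof -
    have "poisson_term x (2 * pi * real (Suc n) / real q) \<le> x / (2 * pi * real (Suc n) / real q)\<^sup>2"
      unfolding poisson_term_def using assms q_pos
      by (intro divide_left_mono) (auto intro!: mult_pos_pos add_pos_nonneg simp del: of_nat_Suc)
    also have "\<dots> = (x * (real q / (2 * pi))\<^sup>2) * (1 / real (Suc n) ^ 2)"
      by (simp add: power2_eq_square)
    finally have "poisson_term x (2 * pi * real (Suc n) / real q) \<le> (x * (real q / (2 * pi))\<^sup>2) * (1 / real (Suc n) ^ 2)" .
    from mult_mono[OF abs_le_bnd[of "int (Suc n)"] this bnd_nonneg] assms show ?thesis
      by (simp add: abs_mult poisson_term_nonneg mult_ac)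
  qed
qed

text \<open>Self-duality replaces each coefficient by a cosine sum over one period. After exchanging
  the finite sum with the series, every residue k leaves the real part of a geometric series with
  ratio exp (- x + 2 pi i k / q).\<close>

lemma theta_eq_sum_Re:
  assumes "x > 0"
  shows "sqrt (real q) * theta x =
    (\<Sum>k<q. a (int k) * Re (1 / (exp (Complex x (- (2 * pi * real k / real q))) - 1)))"
proof -
  have geom: "(\<lambda>n. exp (- (real (Suc n) * x)) * cos (real (Suc n) * \<phi>)) sums Re (1 / (exp (Complex x (- \<phi>)) - 1))" for \<phi>
  proof -
    define e where "e = exp (- Complex x (- \<phi>))"
    have ne: "norm e < 1" using assms by (simp add: e_def norm_exp_eq_Re)
    have "(\<lambda>n. e * e ^ n) sums (e * (1 / (1 - e)))"
      by (intro sums_mult geometric_sums ne)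
    moreover have "e * (1 / (1 - e)) = 1 / (exp (Complex x (- \<phi>)) - 1)"
    proof -
      have "exp (Complex x (- \<phi>)) = inverse e" "e \<noteq> 0" "e \<noteq> 1"
        using ne by (auto simp: e_def exp_minus)
      then show ?thesis by (simp only:) (simp add: field_simps)
    qed
    ultimately have "(\<lambda>n. Re (e ^ Suc n)) sums Re (1 / (exp (Complex x (- \<phi>)) - 1))"
      by (intro sums_Re) simp
    moreover have "Re (e ^ Suc n) = exp (- (real (Suc n) * x)) * cos (real (Suc n) * \<phi>)" for n
    proof -
      have "e ^ Suc n = exp (of_nat (Suc n) * - Complex x (- \<phi>))"
        unfolding e_def exp_of_nat_mult ..
      also have "of_nat (Suc n) * - Complex x (- \<phi>) = Complex (- (real (Suc n) * x)) (real (Suc n) * \<phi>)"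
        by (simp add: complex_eq_iff algebra_simps)
      finally show ?thesis by (simp only: Re_exp complex.sel)
    qed
    ultimately show ?thesis by simp
  qed
  have "(\<lambda>n. \<Sum>k<q. a (int k) * (exp (- (real (Suc n) * x)) * cos (real (Suc n) * (2 * pi * real k / real q))))
     sums (\<Sum>k<q. a (int k) * Re (1 / (exp (Complex x (- (2 * pi * real k / real q))) - 1)))"
    by (intro sums_sum sums_mult geom)
  moreover have "(\<Sum>k<q. a (int k) * (exp (- (real (Suc n) * x)) * cos (real (Suc n) * (2 * pi * real k / real q))))
     = sqrt (real q) * (a (int (Suc n)) * exp (- (real (Suc n) * x)))" for n
  proof -
    have arg: "real (Suc n) * (2 * pi * real k / real q) = 2 * pi * real k * real (Suc n) / real q" for k
      by (simp add: mult_ac)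
    have "(\<Sum>k<q. a (int k) * (exp (- (real (Suc n) * x)) * cos (real (Suc n) * (2 * pi * real k / real q))))
      = exp (- (real (Suc n) * x)) * (\<Sum>k<q. a (int k) * cos (2 * pi * real k * real (Suc n) / real q))"
      unfolding arg sum_distrib_left by (intro sum.cong refl mult.left_commute)
    then show ?thesis unfolding self_dual by (simp only: mult_ac)
  qed
  moreover have "(\<lambda>n. sqrt (real q) * (a (int (Suc n)) * exp (- (real (Suc n) * x)))) sums (sqrt (real q) * theta x)"
    unfolding theta_def
    by (intro sums_mult summable_sums summable_rabs_cancel[OF summable_theta_abs[OF assms]])
  ultimately show ?thesis
    by (simp add: sums_unique2)
qed

text \<open>Each residue class is expanded into Poisson terms. The points 2 pi n - 2 pi k / q and 2
  pi n + 2 pi k / q run through the multiples of 2 pi / q, and evenness and periodicity of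
  \<open>a\<close> turn \<open>a k\<close> into the coefficient belonging to that multiple.\<close>

lemma theta_partial_fractions:
  assumes "x > 0"
  shows "theta x = (a 0 / x + 2 * cauchy_sum x) / sqrt (real q) - a 0 / 2"
proof -
  define t :: "nat \<Rightarrow> real" where "t i = a (int i) * poisson_term x (2 * pi * real i / real q)" for i
  have split: "(\<Sum>i<m + n. f i) = (\<Sum>i<m. f i) + (\<Sum>i<n. f (m + i))" for m n and f :: "nat \<Rightarrow> real"
    by (induction n) simp_all
  have refl: "a (int k) * poisson_term x (2 * pi * real n - 2 * pi * real k / real q) = t (q * n - k)"
    if "k \<le> q * n" for n k
  proof -
    have "a (int k) = a (int (q * n - k))"
      using periodic_mult[of "- int k" "int n"] that by (simp add: even of_nat_diff)
    moreover have "2 * pi * real n - 2 * pi * real k / real q = 2 * pi * real (q * n - k) / real q"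
      using q_pos that by (simp add: of_nat_diff field_simps)
    ultimately show ?thesis by (simp add: t_def)
  qed
  have trans: "a (int k) * poisson_term x (2 * pi * real n + 2 * pi * real k / real q) = t (q * n + k)" for n k
  proof -
    have "a (int k) = a (int (q * n + k))"
      using periodic_mult[of "int k" "int n"] by (simp add: add.commute)
    moreover have "2 * pi * real n + 2 * pi * real k / real q = 2 * pi * real (q * n + k) / real q"
      using q_pos by (simp add: field_simps)
    ultimately show ?thesis by (simp add: t_def)
  qed
  define b where "b k n = poisson_term x (2 * pi * real n - 2 * pi * real k / real q)
       + poisson_term x (2 * pi * real (Suc n) + 2 * pi * real k / real q)" for k n
  \<comment> \<open>The reflected points with n = 0 give the indices below q, and the translates
    give q up to q (m + 2) - 1; together they form the first sum. The reflected points with 1 \<le>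
    n \<le> m give 1 up to q m. Thus index 0 occurs once and every other index twice in the
    limit.\<close>
  have block: "(\<Sum>k<q. a (int k) * (\<Sum>n<Suc m. b k n))
      = (\<Sum>i<q * (m + 2). t i) + (\<Sum>i<q * m. t (Suc i))" for m
  proof (induction m)
    case 0
    have "a (int k) * poisson_term x (- (2 * pi * real k / real q)) = t k" for k
      by (simp add: t_def poisson_term_def)
    then have "a (int k) * b k 0 = t k + t (q + k)" for k
      using trans[of k 1] unfolding b_def distrib_left by simp
    then show ?case
      using split[of t q q] by (simp add: sum.distrib mult_2_right)
  next
    case (Suc m)
    have "a (int k) * b k (Suc m) = t (q * m + Suc (q - Suc k)) + t (q * (m + 2) + k)" if "k < q" for k
    proof -
      have "q * Suc m - k = q * m + Suc (q - Suc k)" using that by simp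
      moreover have "k \<le> q * Suc m" using that by simp
      ultimately show ?thesis
        unfolding b_def distrib_left using refl[of k "Suc m"] trans[of k "Suc (Suc m)"] by (simp add: mult_2_right add_ac)
    qed
    then have "(\<Sum>k<q. a (int k) * b k (Suc m))
        = (\<Sum>k<q. t (q * m + Suc (q - Suc k))) + (\<Sum>k<q. t (q * (m + 2) + k))"
      by (simp add: sum.distrib)
    also have "(\<Sum>k<q. t (q * m + Suc (q - Suc k))) = (\<Sum>k<q. t (Suc (q * m + k)))"
      using sum.nat_diff_reindex[of "\<lambda>k. t (Suc (q * m + k))" q] by simp
    finally have "(\<Sum>k<q. a (int k) * (\<Sum>n<Suc (Suc m). b k n)) =
       ((\<Sum>i<q * (m + 2). t i) + (\<Sum>k<q. t (q * (m + 2) + k)))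
        + ((\<Sum>i<q * m. t (Suc i)) + (\<Sum>k<q. t (Suc (q * m + k))))"
      using Suc.IH by (simp add: distrib_left sum.distrib algebra_simps)
    also have "\<dots> = (\<Sum>i<q * (m + 2) + q. t i) + (\<Sum>i<q * m + q. t (Suc i))"
      by (simp only: split)
    finally show ?case by (simp add: algebra_simps)
  qed
  have t_sums: "(\<lambda>n. t (Suc n)) sums cauchy_sum x"
    unfolding t_def cauchy_sum_def
    by (intro summable_sums summable_rabs_cancel[OF summable_cauchy_abs[OF assms]])
  then have t_sums0: "t sums (cauchy_sum x + t 0)"
    by (rule sums_Suc)
  have lim1: "filterlim (\<lambda>m. q * (m + 2)) at_top sequentially" and lim2: "filterlim (\<lambda>m. q * m) at_top sequentially"
    using q_pos by (auto intro!: filterlim_subseq simp: strict_mono_def)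
  have "(\<lambda>m. (\<Sum>i<q * (m + 2). t i) + (\<Sum>i<q * m. t (Suc i)))
      \<longlonglongrightarrow> (cauchy_sum x + t 0) + cauchy_sum x"
    by (rule tendsto_add[OF filterlim_compose[OF t_sums0[unfolded sums_def] lim1]
          filterlim_compose[OF t_sums[unfolded sums_def] lim2]])
  moreover have "(cauchy_sum x + t 0) + cauchy_sum x = 2 * cauchy_sum x + t 0" by simp
  ultimately have 1: "(\<lambda>m. \<Sum>k<q. a (int k) * (\<Sum>n<Suc m. b k n)) \<longlonglongrightarrow> 2 * cauchy_sum x + t 0"
    unfolding block by (simp only:)
  have "(\<lambda>m. \<Sum>k<q. a (int k) * (\<Sum>n<m. b k n)) \<longlonglongrightarrow>
     (\<Sum>k<q. a (int k) * (Re (1 / (exp (Complex x (- (2 * pi * real k / real q))) - 1)) + 1 / 2))"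
    unfolding b_def by (intro tendsto_sum tendsto_mult tendsto_const Re_inverse_exp_minus_1 assms)
  then have 2: "(\<lambda>m. \<Sum>k<q. a (int k) * (\<Sum>n<Suc m. b k n)) \<longlonglongrightarrow>
     (\<Sum>k<q. a (int k) * (Re (1 / (exp (Complex x (- (2 * pi * real k / real q))) - 1)) + 1 / 2))"
    by (rule LIMSEQ_Suc)
  \<comment> \<open>By \<open>self_dual[of 0]\<close> the sum of \<open>a\<close> over a period is
    \<open>sqrt q * a 0\<close>; this evaluates the contribution of the constants 1/2.\<close>
  have "2 * cauchy_sum x + t 0 = sqrt (real q) * theta x + sqrt (real q) * a 0 / 2"
    using LIMSEQ_unique[OF 1 2] theta_eq_sum_Re[OF assms] self_dual[of 0]
    by (simp add: distrib_left sum.distrib sum_divide_distrib[symmetric])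
  moreover have "t 0 = a 0 / x"
    using assms by (simp add: t_def poisson_term_def power2_eq_square)
  ultimately show ?thesis
    using q_pos by (simp add: field_simps)
qed

end

subsection \<open>Mellin transforms\<close>

text \<open>The integral runs over the whole line. Every \<open>g\<close> transformed below vanishes
  for x \<le> 0, which makes this the usual transform on the half-line; the exponential form of the
  power is convenient for measurability and differentiation in s.\<close>

definition mellin :: "(real \<Rightarrow> real) \<Rightarrow> complex \<Rightarrow> complex" where
  "mellin g s = (\<integral>x. exp ((s - 1) * of_real (ln x)) * of_real (g x) \<partial>lborel)"

lemma integrable_mellin:
  fixes g :: "real \<Rightarrow> real"
  assumes [measurable]: "g \<in> borel_measurable borel"
    and "integrable lborel (\<lambda>x. exp ((Re s - 1) * ln x) * g x)"
  shows "integrable lborel (\<lambda>x. exp ((s - 1) * of_real (ln x)) * of_real (g x) :: complex)"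
  by (rule Bochner_Integration.integrable_bound[OF assms(2)]) (auto simp: norm_mult abs_mult)

lemma mellin_of_real:
  "mellin g (of_real \<sigma>) = of_real (\<integral>x. exp ((\<sigma> - 1) * ln x) * g x \<partial>lborel)"
proof -
  have "exp ((complex_of_real \<sigma> - 1) * of_real (ln x)) * of_real (g x)
      = complex_of_real (exp ((\<sigma> - 1) * ln x) * g x)" for x
    by (simp flip: exp_of_real)
  then show ?thesis by (simp only: mellin_def integral_complex_of_real)
qed

lemma mellin_add:
  fixes g h :: "real \<Rightarrow> real"
  assumes "g \<in> borel_measurable borel" "integrable lborel (\<lambda>x. exp ((Re s - 1) * ln x) * g x)"
    and "h \<in> borel_measurable borel" "integrable lborel (\<lambda>x. exp ((Re s - 1) * ln x) * h x)"
  shows "mellin (\<lambda>x. g x + h x) s = mellin g s + mellin h s"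
  unfolding mellin_def of_real_add distrib_left
  by (intro Bochner_Integration.integral_add integrable_mellin assms)

section \<open>Holomorphy of Mellin transforms\<close>

lemma norm_exp_minus_1_le: "norm (exp z - 1 :: complex) \<le> norm z * exp (norm z)"
  using Taylor_exp_field[of z 0] by (simp add: mult.commute)

text \<open>Differentiation under the integral by dominated convergence: the factor
  \<open>ln x\<close> produced by the derivative is absorbed by slightly larger and slightly smaller
  powers of x, which are still integrable against \<open>g\<close> inside the strip.\<close>

lemma holomorphic_mellin:
  fixes g :: "real \<Rightarrow> real"
  assumes [measurable]: "g \<in> borel_measurable borel"
    and int: "\<And>\<sigma>. \<alpha> < \<sigma> \<Longrightarrow> \<sigma> < \<beta> \<Longrightarrow> integrable lborel (\<lambda>x. exp ((\<sigma> - 1) * ln x) * g x)"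
  shows "mellin g holomorphic_on {s. \<alpha> < Re s \<and> Re s < \<beta>}"
proof (rule holomorphic_onI)
  fix s assume "s \<in> {s. \<alpha> < Re s \<and> Re s < \<beta>}"
  then have s: "\<alpha> < Re s" "Re s < \<beta>" by auto
  \<comment> \<open>The divisor 3 leaves room for the exponents \<open>Re s + 2 * d\<close> and
    \<open>Re s - 2 * d\<close> inside the strip.\<close>
  define d where "d = min (Re s - \<alpha>) (\<beta> - Re s) / 3"
  have d: "d > 0" "\<alpha> < Re s - 2 * d" "Re s + 2 * d < \<beta>"
    using s by (auto simp: d_def min_def field_simps)
  define k where "k z x = exp ((z - 1) * of_real (ln x)) * complex_of_real (g x)" for z x
  define D where "D = (\<integral>x. of_real (ln x) * k s x \<partial>lborel)"
  \<comment> \<open>Majorant of all difference quotients with |h| < d. One d in the exponent bounds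
    exp (h L) - 1, the other absorbs the factor |L|, where L = ln x.\<close>
  define w where "w x = (1 / d) * (exp ((Re s + 2 * d - 1) * ln x) * \<bar>g x\<bar>
        + exp ((Re s - 2 * d - 1) * ln x) * \<bar>g x\<bar>)" for x
  have ik: "integrable lborel (k z)" if "\<alpha> < Re z" "Re z < \<beta>" for z
    unfolding k_def using that by (intro integrable_mellin int assms)
  have iabs: "integrable lborel (\<lambda>x. exp ((\<sigma> - 1) * ln x) * \<bar>g x\<bar>)" if "\<alpha> < \<sigma>" "\<sigma> < \<beta>" for \<sigma>
    using integrable_abs[OF int[OF that]] by (simp add: abs_mult)
  have bound: "norm ((k (s + h) x - k s x) / h) \<le> w x" if h: "h \<noteq> 0" "norm h < d" for h x
  proof -
    define L where "L = ln x"
    have k: "k (s + h) x - k s x = k s x * (exp (h * of_real L) - 1)"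
      by (simp add: k_def L_def ring_distribs exp_add[symmetric] add_ac) (simp add: algebra_simps exp_add[symmetric] exp_diff[symmetric])
    have "norm (exp (h * of_real L) - 1) \<le> norm h * \<bar>L\<bar> * exp (norm h * \<bar>L\<bar>)"
      using norm_exp_minus_1_le[of "h * of_real L"] by (simp add: norm_mult)
    also have "\<dots> \<le> norm h * \<bar>L\<bar> * exp (d * \<bar>L\<bar>)"
      using h by (intro mult_left_mono) (auto intro: mult_right_mono)
    also have "\<dots> \<le> norm h * ((1 / d) * exp (d * \<bar>L\<bar>)) * exp (d * \<bar>L\<bar>)"
    proof -
      have "d * \<bar>L\<bar> \<le> exp (d * \<bar>L\<bar>)"
        using exp_ge_add_one_self[of "d * \<bar>L\<bar>"] by linarith
      then have "\<bar>L\<bar> \<le> (1 / d) * exp (d * \<bar>L\<bar>)"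
        using d by (simp add: field_simps)
      then show ?thesis by (intro mult_right_mono mult_left_mono) auto
    qed
    also have "\<dots> = norm h * ((1 / d) * exp (2 * d * \<bar>L\<bar>))"
      by (simp add: mult_exp_exp)
    also have "\<dots> \<le> norm h * ((1 / d) * (exp (2 * d * L) + exp (- (2 * d * L))))"
      using d by (intro mult_left_mono) (auto simp: abs_if)
    finally have "norm (exp (h * of_real L) - 1) / norm h \<le> (1 / d) * (exp (2 * d * L) + exp (- (2 * d * L)))"
      using h by (simp add: pos_divide_le_eq mult.commute)
    from mult_left_mono[OF this norm_ge_zero[of "k s x"]]
    have "norm ((k (s + h) x - k s x) / h) \<le> norm (k s x) * ((1 / d) * (exp (2 * d * L) + exp (- (2 * d * L))))"
      by (simp add: k norm_divide norm_mult)
    also have "norm (k s x) = exp ((Re s - 1) * L) * \<bar>g x\<bar>"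
      by (simp add: k_def norm_mult L_def)
    also have "\<dots> * ((1 / d) * (exp (2 * d * L) + exp (- (2 * d * L)))) = w x"
    proof -
      have "exp ((Re s + 2 * d - 1) * L) = exp ((Re s - 1) * L) * exp (2 * d * L)"
        "exp ((Re s - 2 * d - 1) * L) = exp ((Re s - 1) * L) * exp (- (2 * d * L))"
        unfolding mult_exp_exp by (simp_all add: algebra_simps)
      then show ?thesis unfolding w_def L_def[symmetric] by (simp add: algebra_simps)
    qed
    finally show ?thesis .
  qed
  have "((\<lambda>h. (mellin g (s + h) - mellin g s) / h) \<longlongrightarrow> D) (at 0 within ball 0 d)"
    unfolding tendsto_at_iff_sequentially
  proof (intro allI impI)
    fix X :: "nat \<Rightarrow> complex"
    assume "\<forall>i. X i \<in> ball 0 d - {0}" and X0: "X \<longlonglongrightarrow> 0"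
    then have X: "X i \<noteq> 0" "norm (X i) < d" for i by auto
    have reX: "\<alpha> < Re (s + X i)" "Re (s + X i) < \<beta>" for i
      using d X(2)[of i] abs_Re_le_cmod[of "X i"] by auto
    have quot: "(mellin g (s + X i) - mellin g s) / X i = (\<integral>x. (k (s + X i) x - k s x) / X i \<partial>lborel)" for i
      using ik[OF s] ik[OF reX[of i]] unfolding mellin_def k_def[symmetric] by simp
    show "((\<lambda>h. (mellin g (s + h) - mellin g s) / h) \<circ> X) \<longlonglongrightarrow> D"
      unfolding o_def quot D_def
    proof (rule integral_dominated_convergence[where w = w])
      show "integrable lborel w"
        unfolding w_def using iabs[of "Re s + 2 * d"] iabs[of "Re s - 2 * d"] d
        by (auto intro!: integrable_mult_right Bochner_Integration.integrable_add)
      show "AE x in lborel. norm ((k (s + X i) x - k s x) / X i) \<le> w x" for i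
        using bound X by auto
      show "(\<lambda>x. of_real (ln x) * k s x) \<in> borel_measurable lborel"
        "(\<lambda>x. (k (s + X i) x - k s x) / X i) \<in> borel_measurable lborel" for i
        unfolding k_def by measurable
      have "((\<lambda>z. k z x) has_field_derivative of_real (ln x) * k s x) (at s)" for x
        unfolding k_def by (auto intro!: derivative_eq_intros)
      then have "((\<lambda>h. (k (s + h) x - k s x) / h) \<longlongrightarrow> of_real (ln x) * k s x) (at 0)" for x
        by (simp add: DERIV_def)
      then have "(\<lambda>i. (k (s + X i) x - k s x) / X i) \<longlonglongrightarrow> of_real (ln x) * k s x" for x
        using X X0 unfolding tendsto_at_iff_sequentially by (auto simp: o_def)
      then show "AE x in lborel. (\<lambda>i. (k (s + X i) x - k s x) / X i) \<longlonglongrightarrow> of_real (ln x) * k s x"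
        by simp
    qed
  qed
  then have "(mellin g has_field_derivative D) (at s)"
    using d by (simp add: DERIV_def at_within_open[of 0 "ball 0 d"])
  then show "mellin g field_differentiable at s within {s. \<alpha> < Re s \<and> Re s < \<beta>}"
    using field_differentiable_at_within field_differentiable_def by blast
qed

section \<open>Elementary integrals and termwise integration\<close>

lemma has_bochner_integral_lborel_absolutely_integrable_on:
  fixes f :: "real \<Rightarrow> 'a :: euclidean_space"
  assumes "f absolutely_integrable_on S" "(\<lambda>x. indicator S x *\<^sub>R f x) \<in> borel_measurable borel"
  shows "has_bochner_integral lborel (\<lambda>x. indicator S x *\<^sub>R f x) (integral S f)"
proof -
  \<comment> \<open>Absolute integrability refers to the completed measure; Borel measurability
    brings the integral down to \<open>lborel\<close>.\<close>
  have "integrable lborel (\<lambda>x. indicator S x *\<^sub>R f x)"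
    using assms by (simp add: set_integrable_def integrable_completion)
  moreover have "(\<integral>x. indicator S x *\<^sub>R f x \<partial>lborel) = integral S f"
    using set_lebesgue_integral_eq_integral(2)[OF assms(1)] assms(2)
    by (simp add: set_lebesgue_integral_def integral_completion)
  ultimately show ?thesis by (simp add: has_bochner_integral_iff)
qed

lemma powr_eq_exp_ln:
  assumes "x > 0"
  shows "complex_of_real x powr z = exp (z * of_real (ln x))" "x powr r = exp (r * ln x)"
  using assms by (simp_all add: powr_def Ln_of_real)

text \<open>Euler's integral under the substitution of n x for x; dividing by n to the power s - 1
  restores the unscaled kernel.\<close>

lemma Gamma_integral_scaled:
  assumes s: "Re s > 0" and n: "n > (0 :: real)"
  shows "has_bochner_integral lborel
     (\<lambda>x. exp ((s - 1) * of_real (ln x)) * of_real (indicator {0<..} x * exp (- (n * x))))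
     (Gamma s / of_real n powr s)"
proof -
  define f where "f x = indicator {0<..} x *\<^sub>R (exp ((s - 1) * of_real (ln x)) * of_real (exp (- x)) :: complex)" for x
  have [measurable]: "f \<in> borel_measurable borel" unfolding f_def by measurable
  have f: "f = (\<lambda>x. indicator {0<..} x *\<^sub>R (of_real x powr (s - 1) / of_real (exp x)))"
    by (auto simp: f_def powr_eq_exp_ln exp_minus field_simps split: split_indicator)
  have "has_bochner_integral lborel f (Gamma s)"
    using has_bochner_integral_lborel_absolutely_integrable_on[OF absolutely_integrable_Gamma_integral'[OF s]]
      Gamma_integral_complex'[OF s] \<open>f \<in> borel_measurable borel\<close> by (simp add: f integral_unique)
  then have "has_bochner_integral lborel (\<lambda>x. f (n * x)) (Gamma s /\<^sub>R n)"
    using lborel_has_bochner_integral_real_affine_iff[of n f "Gamma s" 0] n by simp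
  then have "has_bochner_integral lborel (\<lambda>x. f (n * x) / of_real n powr (s - 1)) (Gamma s /\<^sub>R n / of_real n powr (s - 1))"
    by (rule has_bochner_integral_divide_zero)
  moreover have "Gamma s /\<^sub>R n / of_real n powr (s - 1) = Gamma s / of_real n powr s"
    using n by (simp add: powr_diff scaleR_conv_of_real field_simps)
  moreover have "f (n * x) / of_real n powr (s - 1)
      = exp ((s - 1) * of_real (ln x)) * of_real (indicator {0<..} x * exp (- (n * x)))" for x
  proof (cases "x > 0")
    case True
    then have "exp ((s - 1) * of_real (ln (n * x))) = of_real n powr (s - 1) * exp ((s - 1) * of_real (ln x))"
      using n by (simp add: powr_eq_exp_ln ln_mult mult_exp_exp algebra_simps)
    with True n show ?thesis by (simp add: f_def)
  next
    case False
    with n show ?thesis by (simp add: f_def mult_le_0_iff zero_less_mult_iff indicator_def)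
  qed
  ultimately show ?thesis by simp
qed


text \<open>The substitution t = x^2 / (x^2 + b^2) gives a Beta integral with parameters (1 + s)/2
  and (1 - s)/2, both positive exactly in the given range. They add up to 1, so the reflection
  formula evaluates it.\<close>

lemma rational_mellin_integral:
  assumes s: "-1 < s" "s < 1" and b: "b > (0 :: real)"
  shows "has_bochner_integral lborel
     (\<lambda>x. exp ((s - 1) * ln x) * (indicator {0<..} x * (x / (x\<^sup>2 + b\<^sup>2))))
     (b powr (s - 1) * (pi / (2 * cos (pi * s / 2))))"
proof -
  define \<alpha> \<beta> where "\<alpha> = (1 + s) / 2" and "\<beta> = (1 - s) / 2"
  have ab: "\<alpha> > 0" "\<beta> > 0" using s by (auto simp: \<alpha>_def \<beta>_def)
  define f where "f t = t powr (\<alpha> - 1) * (1 - t) powr (\<beta> - 1)" for t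
  define g where "g x = x\<^sup>2 / (x\<^sup>2 + b\<^sup>2)" for x
  define g' where "g' x = 2 * x * b\<^sup>2 / (x\<^sup>2 + b\<^sup>2)\<^sup>2" for x
  have pos: "x\<^sup>2 + b\<^sup>2 > 0" for x using b by (simp add: add_nonneg_pos)
  have "(f has_integral Beta \<alpha> \<beta>) {0..1}"
    unfolding f_def by (rule has_integral_Beta_real[OF ab])
  then have hi: "(f has_integral Beta \<alpha> \<beta>) {0<..<1}"
    by (simp add: has_integral_Icc_iff_Ioo)
  then have fint: "f absolutely_integrable_on {0<..<1}" "integral {0<..<1} f = Beta \<alpha> \<beta>"
    by (auto intro!: nonnegative_absolutely_integrable_1 simp: f_def integral_unique has_integral_integrable)
  have inj: "inj_on g {0<..}"
  proof (rule inj_onI)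
    fix x y assume "x \<in> {0<..}" "y \<in> {0<..}" "g x = g y"
    then have "x\<^sup>2 * b\<^sup>2 = y\<^sup>2 * b\<^sup>2"
      using pos[of x] pos[of y] by (simp add: g_def divide_simps) (simp add: algebra_simps)
    then show "x = y" using b \<open>x \<in> _\<close> \<open>y \<in> _\<close> by simp
  qed
  have img: "g ` {0<..} = {0<..<1}"
  proof (intro equalityI subsetI)
    fix t assume "t \<in> g ` {0<..}"
    then show "t \<in> {0<..<1}" using pos b by (auto simp: g_def)
  next
    fix t :: real assume t: "t \<in> {0<..<1}"
    \<comment> \<open>The solution of \<open>g x = t\<close> on the positive half-line.\<close>
    define x where "x = b * sqrt (t / (1 - t))"
    have x2: "x\<^sup>2 = b\<^sup>2 * (t / (1 - t))" using t by (simp add: x_def power_mult_distrib)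
    have "g x = t" unfolding g_def x2 using t b by (simp add: divide_simps) (simp add: algebra_simps)
    moreover have "x > 0" using t b by (simp add: x_def)
    ultimately show "t \<in> g ` {0<..}" by force
  qed
  have deriv: "(g has_field_derivative g' x) (at x within {0<..})" for x
    unfolding g_def g'_def using pos[of x]
    by (auto intro!: derivative_eq_intros simp: power2_eq_square algebra_simps)
  have "(\<lambda>x. \<bar>g' x\<bar> * f (g x)) absolutely_integrable_on {0<..} \<and>
      integral {0<..} (\<lambda>x. \<bar>g' x\<bar> * f (g x)) = Beta \<alpha> \<beta>"
    using fint unfolding has_absolute_integral_change_of_variables_1'[OF _ deriv inj, simplified] img by blast
  moreover have "(\<lambda>x. indicator {0<..} x *\<^sub>R (\<bar>g' x\<bar> * f (g x))) \<in> borel_measurable borel"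
    unfolding g'_def f_def g_def by measurable
  ultimately have "has_bochner_integral lborel (\<lambda>x. indicator {0<..} x *\<^sub>R (\<bar>g' x\<bar> * f (g x))) (Beta \<alpha> \<beta>)"
    using has_bochner_integral_lborel_absolutely_integrable_on by metis
  then have "has_bochner_integral lborel (\<lambda>x. b powr (s - 1) / 2 * (indicator {0<..} x *\<^sub>R (\<bar>g' x\<bar> * f (g x))))
      (b powr (s - 1) / 2 * Beta \<alpha> \<beta>)"
    by (intro has_bochner_integral_mult_right)
  moreover have "b powr (s - 1) / 2 * (indicator {0<..} x *\<^sub>R (\<bar>g' x\<bar> * f (g x)))
      = exp ((s - 1) * ln x) * (indicator {0<..} x * (x / (x\<^sup>2 + b\<^sup>2)))" for x
  proof (cases "x > 0")
    case True
    define N where "N = x\<^sup>2 + b\<^sup>2"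
    have N: "N > 0" using pos by (simp add: N_def)
    have "b\<^sup>2 = N - x\<^sup>2" by (simp add: N_def)
    then have "1 - g x = b\<^sup>2 / N"
      using N unfolding g_def N_def[symmetric] by (simp only: diff_divide_distrib) simp
    then have "f (g x) = (x\<^sup>2 / N) powr (\<alpha> - 1) * (b\<^sup>2 / N) powr (\<beta> - 1)"
      by (simp add: f_def g_def N_def)
    also have "\<dots> = exp ((s - 1) * ln x - (s + 1) * ln b + ln N)"
      using True N b by (simp add: powr_def ln_div ln_realpow mult_exp_exp \<alpha>_def \<beta>_def field_simps)
    also have "\<dots> = exp ((s - 1) * ln x) * b powr (- (s + 1)) * N"
      using b N by (simp add: exp_add exp_diff powr_minus powr_def field_simps exp_minus)
    finally have "b powr (s - 1) / 2 * (\<bar>g' x\<bar> * f (g x))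
       = (b powr (s - 1) * b powr (- (s + 1)) * b\<^sup>2) * (exp ((s - 1) * ln x) * (x / N))"
      using True N unfolding g'_def N_def[symmetric] by (simp add: abs_mult power2_eq_square field_simps)
    also have "b powr (s - 1) * b powr (- (s + 1)) * b\<^sup>2 = 1"
      using b by (simp flip: powr_add powr_numeral)
    finally show ?thesis
      unfolding N_def using True by (simp only: indicator_simps greaterThan_iff scaleR_one mult_1_left)
  qed simp
  moreover have "Beta \<alpha> \<beta> = pi / cos (pi * s / 2)"
  proof -
    have "complex_of_real (Beta \<alpha> \<beta>) = Beta (of_real \<alpha>) (of_real \<beta>)"
      by (simp add: Beta_complex_of_real)
    also have "\<dots> = Gamma (of_real \<alpha>) * Gamma (1 - of_real \<alpha>)"
      by (simp add: Beta_def \<alpha>_def \<beta>_def field_simps)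
    also have "\<dots> = of_real pi / sin (of_real pi * of_real \<alpha>)"
      by (rule Gamma_reflection_complex)
    also have "\<dots> = of_real (pi / sin (pi * \<alpha>))"
      by (simp flip: sin_of_real)
    also have "pi * \<alpha> = pi * s / 2 + pi / 2"
      by (simp add: \<alpha>_def field_simps)
    finally have "Beta \<alpha> \<beta> = pi / sin (pi * s / 2 + pi / 2)" by (simp only: of_real_eq_iff)
    then show ?thesis by (simp add: sin_add)
  qed
  then have "b powr (s - 1) / 2 * Beta \<alpha> \<beta> = b powr (s - 1) * (pi / (2 * cos (pi * s / 2)))"
    by simp
  ultimately show ?thesis by (simp only:)
qed


text \<open>Exchange of sum and integral, justified by absolute convergence: \<open>J n\<close> is
  the integral of the absolute value of the n-th integrand, so its summability controls the complex
  integrals as well.\<close>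

lemma mellin_sums:
  fixes u :: "nat \<Rightarrow> real \<Rightarrow> real"
  assumes [measurable]: "\<And>n. u n \<in> borel_measurable borel"
    and summable: "\<And>x. summable (\<lambda>n. \<bar>u n x\<bar>)"
    and int: "\<And>n. has_bochner_integral lborel (\<lambda>x. exp ((Re s - 1) * ln x) * \<bar>u n x\<bar>) (J n)"
    and "summable J"
  shows "integrable lborel (\<lambda>x. exp ((Re s - 1) * ln x) * (\<Sum>n. u n x))"
    and "(\<lambda>n. mellin (u n) s) sums mellin (\<lambda>x. \<Sum>n. u n x) s"
proof -
  have ireal: "integrable lborel (\<lambda>x. exp ((Re s - 1) * ln x) * u n x)" for n
    by (rule Bochner_Integration.integrable_bound[OF integrable.intros[OF int[of n]]]) (auto simp: abs_mult)
  have "(\<integral>x. \<bar>exp ((Re s - 1) * ln x) * u n x\<bar> \<partial>lborel) = J n" for n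
    using int[of n] by (simp add: abs_mult has_bochner_integral_iff)
  then have J: "summable (\<lambda>n. \<integral>x. \<bar>exp ((Re s - 1) * ln x) * u n x\<bar> \<partial>lborel)"
    using assms by simp
  have sm: "summable (\<lambda>n. \<bar>exp ((Re s - 1) * ln x) * u n x\<bar>)" for x
    using summable_mult[OF summable[of x], of "exp ((Re s - 1) * ln x)"] by (simp add: abs_mult)
  have su: "summable (\<lambda>n. u n x)" for x
    by (rule summable_rabs_cancel[OF summable])
  have "integrable lborel (\<lambda>x. \<Sum>n. exp ((Re s - 1) * ln x) * u n x)"
    by (rule integrable_suminf[OF ireal]) (use sm J in auto)
  then show "integrable lborel (\<lambda>x. exp ((Re s - 1) * ln x) * (\<Sum>n. u n x))"
    using su by (simp add: suminf_mult)
  have norm: "norm (exp ((s - 1) * of_real (ln x)) * of_real (u n x)) = \<bar>exp ((Re s - 1) * ln x) * u n x\<bar>" for n x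
    by (simp add: norm_mult abs_mult)
  have "(\<lambda>n. \<integral>x. exp ((s - 1) * of_real (ln x)) * of_real (u n x) \<partial>lborel)
     sums (\<integral>x. (\<Sum>n. exp ((s - 1) * of_real (ln x)) * of_real (u n x)) \<partial>lborel)"
    by (rule sums_integral) (use sm J in \<open>simp_all add: norm integrable_mellin ireal\<close>)
  moreover have "(\<Sum>n. exp ((s - 1) * of_real (ln x)) * of_real (u n x))
      = exp ((s - 1) * of_real (ln x)) * of_real (\<Sum>n. u n x)" for x
    by (rule sums_unique[symmetric]) (intro sums_mult sums_of_real summable_sums su)
  ultimately show "(\<lambda>n. mellin (u n) s) sums mellin (\<lambda>x. \<Sum>n. u n x) s"
    by (simp add: mellin_def)
qed

lemma Gamma_integral_scaled_real:
  assumes s: "s > 0" and n: "n > (0 :: real)"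
  shows "has_bochner_integral lborel
     (\<lambda>x. exp ((s - 1) * ln x) * (indicator {0<..} x * exp (- (n * x)))) (Gamma s / n powr s)"
proof -
  have "exp ((complex_of_real s - 1) * of_real (ln x)) * of_real (indicator {0<..} x * exp (- (n * x)))
      = of_real (exp ((s - 1) * ln x) * (indicator {0<..} x * exp (- (n * x))))" for x
    by (simp flip: exp_of_real)
  moreover have "Gamma (complex_of_real s) / of_real n powr of_real s = of_real (Gamma s / n powr s)"
    using n by (simp add: Gamma_complex_of_real powr_of_real)
  ultimately have "has_bochner_integral lborel
     (\<lambda>x. complex_of_real (exp ((s - 1) * ln x) * (indicator {0<..} x * exp (- (n * x))))) (of_real (Gamma s / n powr s))"
    using Gamma_integral_scaled[of "of_real s" n] s n by (simp only: Re_complex_of_real)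
  then show ?thesis
    unfolding has_bochner_integral_iff integral_complex_of_real of_real_eq_iff
    using complex_of_real_integrable_eq by blast
qed

lemma mellin_indicator_unit:
  assumes "Re s > 0"
  shows "integrable lborel (\<lambda>x. exp ((Re s - 1) * ln x) * indicator {0<..1} x)"
    and "mellin (indicator {0<..1}) s = 1 / s"
proof -
  have pw: "indicator {0<..1} x *\<^sub>R (x powr (Re s - 1)) = exp ((Re s - 1) * ln x) * indicator {0<..1} x"
    "indicator {0<..1} x *\<^sub>R (of_real x powr (s - 1)) = exp ((s - 1) * of_real (ln x)) * of_real (indicator {0<..1} x)" for x :: real
    by (auto simp: powr_eq_exp_ln split: split_indicator)
  \<comment> \<open>Dropping the endpoint 0 changes a negligible set only and matches the indicators
    used by \<open>mellin\<close>.\<close>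
  have Ioc: "(f has_integral y) {0<..1}" if "(f has_integral y) {0..1}" for f :: "real \<Rightarrow> 'a :: euclidean_space" and y
  proof -
    have "negligible {x \<in> {0..1} - {0<..1}. f x \<noteq> 0}" "negligible {x \<in> {0<..1} - {0..1}. f x \<noteq> 0}"
      by (rule negligible_subset[of "{0 :: real}"]; force)+
    from has_integral_spike_set_eq[OF this] that show ?thesis by blast
  qed
  have "((\<lambda>x. x powr (Re s - 1)) has_integral 1 / Re s) {0<..1}"
    using has_integral_powr_from_0[of "Re s - 1" 1] assms by (intro Ioc) auto
  then have abs: "(\<lambda>x. x powr (Re s - 1)) absolutely_integrable_on {0<..1}"
    by (intro nonnegative_absolutely_integrable_1) (auto simp: has_integral_integrable)
  show *: "integrable lborel (\<lambda>x. exp ((Re s - 1) * ln x) * indicator {0<..1} x)"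
    using has_bochner_integral_lborel_absolutely_integrable_on[OF abs]
    unfolding pw by (auto simp: has_bochner_integral_iff)
  have "((\<lambda>x. complex_of_real x powr (s - 1)) has_integral (of_real 1 powr s / s - of_real 0 powr s / s)) {0..1}"
    using assms by (intro fundamental_theorem_of_calculus_interior)
      (auto intro!: continuous_intros derivative_eq_intros has_vector_derivative_real_field)
  then have hi: "((\<lambda>x. complex_of_real x powr (s - 1)) has_integral 1 / s) {0<..1}"
    by (intro Ioc) auto
  have "integrable lborel (\<lambda>x. indicator {0<..1} x *\<^sub>R (complex_of_real x powr (s - 1)))"
    unfolding pw using * by (intro integrable_mellin) auto
  from has_integral_integral_lborel[OF this] 
  have "((\<lambda>x. indicator {0<..1} x *\<^sub>R (complex_of_real x powr (s - 1))) has_integral mellin (indicator {0<..1}) s) UNIV"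
    unfolding mellin_def pw .
  moreover have "((\<lambda>x. indicator {0<..1} x *\<^sub>R (complex_of_real x powr (s - 1))) has_integral 1 / s) UNIV"
    using hi by (subst (asm) has_integral_restrict_UNIV[symmetric]) (simp add: indicator_def if_distrib[of "\<lambda>y. y *\<^sub>R _"] of_bool_def cong: if_cong)
  ultimately show "mellin (indicator {0<..1}) s = 1 / s"
    by (rule has_integral_unique)
qed

text \<open>Up to sign this is the rational function found for the unit interval, now in the
  opposite half-plane. That agreement carries the polar terms across.\<close>

lemma mellin_indicator_above:
  fixes s :: real
  assumes "s < 0"
  shows "has_bochner_integral lborel (\<lambda>x. exp ((s - 1) * ln x) * indicator {1<..} x) (- 1 / s)"
proof -
  have pw: "indicator {1<..} x *\<^sub>R (x powr (s - 1)) = exp ((s - 1) * ln x) * indicator {1<..} x" for x :: real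
    by (auto simp: powr_eq_exp_ln split: split_indicator)
  have "((\<lambda>x. x powr (s - 1)) has_integral - 1 / s) {1..}"
    using has_integral_powr_to_inf[of "s - 1" 1] assms by simp
  moreover have "negligible {x \<in> {1..} - {1<..}. x powr (s - 1) \<noteq> 0}"
    "negligible {x \<in> {1<..} - {1..}. x powr (s - 1) \<noteq> 0}"
    by (rule negligible_subset[of "{1 :: real}"]; force)+
  ultimately have hi: "((\<lambda>x. x powr (s - 1)) has_integral - 1 / s) {1<..}"
    using has_integral_spike_set_eq[of "{1..}" "{1<..}" "\<lambda>x. x powr (s - 1)" "- 1 / s"] by blast
  then have abs: "(\<lambda>x. x powr (s - 1)) absolutely_integrable_on {1<..}"
    by (intro nonnegative_absolutely_integrable_1) (auto simp: has_integral_integrable)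
  show ?thesis
    by (rule has_bochner_integral_lborel_absolutely_integrable_on[OF abs, unfolded pw integral_unique[OF hi]]) measurable
qed

section \<open>Mellin transforms of the two sides of the partial fraction identity\<close>

context self_dual_even
begin

text \<open>By \<open>self_dual\<close> at 0 this is the mean of \<open>a\<close> over a period; it
  turns out to be the residue of the continued series at 1.\<close>

definition L_residue :: real where "L_residue = a 0 / sqrt (real q)"

definition theta_pos :: "real \<Rightarrow> real" where
  "theta_pos x = indicator {0<..} x * theta x"

text \<open>The expansion of \<open>theta\<close> on the positive half-line with the two terms in 1
  / x and 1 removed.\<close>

definition cauchy_pos :: "real \<Rightarrow> real" where
  "cauchy_pos x = indicator {0<..} x * (2 / sqrt (real q) * cauchy_sum x)"

lemma measurable_theta [measurable]: "theta \<in> borel_measurable borel"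
  unfolding theta_def by measurable

lemma measurable_cauchy_sum [measurable]: "cauchy_sum \<in> borel_measurable borel"
  unfolding cauchy_sum_def poisson_term_def by measurable

lemma measurable_pos [measurable]:
  "theta_pos \<in> borel_measurable borel" "cauchy_pos \<in> borel_measurable borel"
  unfolding theta_pos_def cauchy_pos_def by measurable

lemma summable_bnd_powr:
  assumes "\<sigma> > 1"
  shows "summable (\<lambda>n. C * \<bar>a (int (Suc n))\<bar> * real (Suc n) powr - \<sigma>)"
proof (rule summable_comparison_test', rule summable_mult)
  show "summable (\<lambda>n. real (Suc n) powr - \<sigma>)"
    using assms by (subst summable_Suc_iff) (simp add: summable_real_powr_iff)
  show "norm (C * \<bar>a (int (Suc n))\<bar> * real (Suc n) powr - \<sigma>) \<le> \<bar>C\<bar> * bnd * real (Suc n) powr - \<sigma>" for n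
    using abs_le_bnd[of "int (Suc n)"] by (simp add: abs_mult mult_right_mono mult_left_mono)
qed

text \<open>Termwise integration produces \<open>Gamma s\<close> times the Dirichlet series.
  Multiplying by \<open>rGamma s\<close> isolates the series.\<close>

lemma
  assumes "Re s > 1"
  shows integrable_theta_pos: "integrable lborel (\<lambda>x. exp ((Re s - 1) * ln x) * theta_pos x)"
    and theta_pos_sums: "(\<lambda>n. of_real (a (int (Suc n))) / of_nat (Suc n) powr s) sums (rGamma s * mellin theta_pos s)"
proof -
  define u where "u n x = a (int (Suc n)) * (indicator {0<..} x * exp (- (real (Suc n) * x)))" for n x
  have [measurable]: "u n \<in> borel_measurable borel" for n
    unfolding u_def by measurable
  have abs_u: "\<bar>u n x\<bar> = indicator {0<..} x * \<bar>a (int (Suc n)) * exp (- (real (Suc n) * x))\<bar>" for n x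
    by (simp add: u_def abs_mult)
  have summ: "summable (\<lambda>n. \<bar>u n x\<bar>)" for x
    using summable_theta_abs[of x] by (cases "x > 0") (simp_all add: abs_u)
  have int: "has_bochner_integral lborel (\<lambda>x. exp ((Re s - 1) * ln x) * \<bar>u n x\<bar>)
      (Gamma (Re s) * \<bar>a (int (Suc n))\<bar> * real (Suc n) powr - Re s)" for n
  proof -
    have "has_bochner_integral lborel
     (\<lambda>x. \<bar>a (int (Suc n))\<bar> * (exp ((Re s - 1) * ln x) * (indicator {0<..} x * exp (- (real (Suc n) * x)))))
     (\<bar>a (int (Suc n))\<bar> * (Gamma (Re s) / real (Suc n) powr Re s))"
      using assms by (intro has_bochner_integral_mult_right Gamma_integral_scaled_real) auto
    moreover have "\<bar>a (int (Suc n))\<bar> * (exp ((Re s - 1) * ln x) * (indicator {0<..} x * exp (- (real (Suc n) * x))))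
       = exp ((Re s - 1) * ln x) * \<bar>u n x\<bar>" for x
      by (simp add: abs_u abs_mult mult_ac)
    moreover have "\<bar>a (int (Suc n))\<bar> * (Gamma (Re s) / real (Suc n) powr Re s)
       = Gamma (Re s) * \<bar>a (int (Suc n))\<bar> * real (Suc n) powr - Re s"
      by (simp add: powr_minus divide_inverse mult_ac)
    ultimately show ?thesis by (simp only:)
  qed
  have sum_u: "(\<Sum>n. u n x) = theta_pos x" for x
  proof (cases "x > 0")
    case True
    then show ?thesis by (simp add: u_def theta_pos_def theta_def)
  qed (simp add: u_def theta_pos_def)
  have mel: "mellin (u n) s = of_real (a (int (Suc n))) * (Gamma s / of_nat (Suc n) powr s)" for n
  proof -
    have "mellin (u n) s = (\<integral>x. of_real (a (int (Suc n))) * (exp ((s - 1) * of_real (ln x)) * of_real (indicator {0<..} x * exp (- (real (Suc n) * x)))) \<partial>lborel)"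
      unfolding mellin_def u_def of_real_mult by (simp only: mult_ac)
    also have "\<dots> = of_real (a (int (Suc n))) * (Gamma s / of_nat (Suc n) powr s)"
      using Gamma_integral_scaled[of s "real (Suc n)"] assms
      by (subst integral_mult_right_zero) (simp add: has_bochner_integral_iff)
    finally show ?thesis .
  qed
  note * = mellin_sums[of u s, OF _ summ int summable_bnd_powr[OF assms], unfolded sum_u]
  show "integrable lborel (\<lambda>x. exp ((Re s - 1) * ln x) * theta_pos x)"
    by (rule *(1)) measurable
  have "(\<lambda>n. rGamma s * mellin (u n) s) sums (rGamma s * mellin theta_pos s)"
    by (intro sums_mult *(2)) measurable
  moreover have "Gamma s \<noteq> 0"
    using assms by (auto simp: Gamma_eq_zero_iff elim!: nonpos_Ints_cases)
  then have "rGamma s * mellin (u n) s = of_real (a (int (Suc n))) / of_nat (Suc n) powr s" for n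
    by (simp add: mel rGamma_inverse_Gamma)
  ultimately show "(\<lambda>n. of_real (a (int (Suc n))) / of_nat (Suc n) powr s) sums (rGamma s * mellin theta_pos s)"
    by (simp only:)
qed

text \<open>The n-th term integrates to a constant times n to the power \<sigma> - 1, so the
  Dirichlet series reappears at 1 - \<sigma>. The bound -1 < \<sigma> makes each integral converge
  at 0, and \<sigma> < 0 makes the sum over n converge absolutely.\<close>

lemma
  assumes "-1 < \<sigma>" "\<sigma> < 0"
  shows integrable_cauchy_pos: "integrable lborel (\<lambda>x. exp ((\<sigma> - 1) * ln x) * cauchy_pos x)"
    and mellin_cauchy_pos: "mellin cauchy_pos (of_real \<sigma>) =
       of_real (pi / (sqrt (real q) * cos (pi * \<sigma> / 2)) * (2 * pi / real q) powr (\<sigma> - 1))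
         * (rGamma (1 - of_real \<sigma>) * mellin theta_pos (1 - of_real \<sigma>))"
proof -
  define b where "b n = 2 * pi * real (Suc n) / real q" for n
  have b: "b n > 0" for n using q_pos by (simp add: b_def)
  define v where "v n x = 2 / sqrt (real q) * a (int (Suc n)) * (indicator {0<..} x * (x / (x\<^sup>2 + (b n)\<^sup>2)))" for n x
  define K where "K = pi / (sqrt (real q) * cos (pi * \<sigma> / 2)) * (2 * pi / real q) powr (\<sigma> - 1)"
  have [measurable]: "v n \<in> borel_measurable borel" for n
    unfolding v_def by measurable
  have abs_v: "\<bar>v n x\<bar> = 2 / sqrt (real q) * (indicator {0<..} x * \<bar>a (int (Suc n)) * poisson_term x (b n)\<bar>)" for n x
    by (simp add: v_def abs_mult poisson_term_def)
  have summ: "summable (\<lambda>n. \<bar>v n x\<bar>)" for x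
    using summable_cauchy_abs[of x] by (cases "x > 0") (auto simp: abs_v b_def intro!: summable_mult)
  have bp: "2 / sqrt (real q) * y * (b n powr (\<sigma> - 1) * (pi / (2 * cos (pi * \<sigma> / 2))))
       = K * y * real (Suc n) powr - (1 - \<sigma>)" for y n
  proof -
    have "b n powr (\<sigma> - 1) = (2 * pi / real q) powr (\<sigma> - 1) * real (Suc n) powr - (1 - \<sigma>)"
      unfolding b_def by (simp flip: powr_mult)
    then show ?thesis by (simp add: K_def)
  qed
  have int: "has_bochner_integral lborel (\<lambda>x. exp ((\<sigma> - 1) * ln x) * v n x)
      (K * a (int (Suc n)) * real (Suc n) powr - (1 - \<sigma>))" 
    and int_abs: "has_bochner_integral lborel (\<lambda>x. exp ((\<sigma> - 1) * ln x) * \<bar>v n x\<bar>)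
      (K * \<bar>a (int (Suc n))\<bar> * real (Suc n) powr - (1 - \<sigma>))" for n
  proof -
    \<comment> \<open>The free factor y is taken once as the coefficient and once as its absolute
      value.\<close>
    have base: "has_bochner_integral lborel
     (\<lambda>x. 2 / sqrt (real q) * y * (exp ((\<sigma> - 1) * ln x) * (indicator {0<..} x * (x / (x\<^sup>2 + (b n)\<^sup>2)))))
     (K * y * real (Suc n) powr - (1 - \<sigma>))" for y
      unfolding bp[symmetric] using assms b
      by (intro has_bochner_integral_mult_right rational_mellin_integral) auto
    have e1: "2 / sqrt (real q) * a (int (Suc n)) * (exp ((\<sigma> - 1) * ln x) * (indicator {0<..} x * (x / (x\<^sup>2 + (b n)\<^sup>2))))
       = exp ((\<sigma> - 1) * ln x) * v n x" for x
      by (simp add: v_def)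
    have e2: "2 / sqrt (real q) * \<bar>a (int (Suc n))\<bar> * (exp ((\<sigma> - 1) * ln x) * (indicator {0<..} x * (x / (x\<^sup>2 + (b n)\<^sup>2))))
       = exp ((\<sigma> - 1) * ln x) * \<bar>v n x\<bar>" for x
      by (cases "x > 0") (simp_all add: v_def abs_mult)
    show "has_bochner_integral lborel (\<lambda>x. exp ((\<sigma> - 1) * ln x) * v n x)
      (K * a (int (Suc n)) * real (Suc n) powr - (1 - \<sigma>))"
      using base[of "a (int (Suc n))"] by (simp only: e1)
    show "has_bochner_integral lborel (\<lambda>x. exp ((\<sigma> - 1) * ln x) * \<bar>v n x\<bar>)
      (K * \<bar>a (int (Suc n))\<bar> * real (Suc n) powr - (1 - \<sigma>))"
      using base[of "\<bar>a (int (Suc n))\<bar>"] by (simp only: e2)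
  qed
  have sum_v: "(\<Sum>n. v n x) = cauchy_pos x" for x
  proof (cases "x > 0")
    case True
    have "(\<Sum>n. 2 / sqrt (real q) * (a (int (Suc n)) * poisson_term x (b n))) = 2 / sqrt (real q) * cauchy_sum x"
      unfolding b_def cauchy_sum_def
      by (intro suminf_mult summable_rabs_cancel[OF summable_cauchy_abs[OF True]])
    with True show ?thesis by (simp add: v_def cauchy_pos_def poisson_term_def mult_ac)
  qed (simp add: v_def cauchy_pos_def)
  have "1 - \<sigma> > 1" using assms by simp
  note * = mellin_sums[of v "of_real \<sigma>", unfolded Re_complex_of_real, OF _ summ int_abs summable_bnd_powr[OF this], unfolded sum_v]
  show "integrable lborel (\<lambda>x. exp ((\<sigma> - 1) * ln x) * cauchy_pos x)"
    by (rule *(1)) measurable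
  have "(\<lambda>n. mellin (v n) (of_real \<sigma>)) sums mellin cauchy_pos (of_real \<sigma>)"
    by (rule *(2)) measurable
  moreover have "mellin (v n) (of_real \<sigma>) = of_real K * (of_real (a (int (Suc n))) / of_nat (Suc n) powr (1 - of_real \<sigma>))" for n
  proof -
    have "of_nat (Suc n) powr (1 - complex_of_real \<sigma>) = of_real (real (Suc n) powr (1 - \<sigma>))"
      using powr_of_real[of "real (Suc n)" "1 - \<sigma>"] by simp
    then show ?thesis
      using int[of n] unfolding mellin_of_real has_bochner_integral_iff powr_minus
      by (simp only: of_real_mult of_real_inverse divide_inverse mult.assoc)
  qed
  moreover have "(\<lambda>n. of_real K * (of_real (a (int (Suc n))) / of_nat (Suc n) powr (1 - of_real \<sigma>)))
     sums (of_real K * (rGamma (1 - of_real \<sigma>) * mellin theta_pos (1 - of_real \<sigma>)))"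
    using assms by (intro sums_mult theta_pos_sums) simp
  ultimately show "mellin cauchy_pos (of_real \<sigma>) =
       of_real (pi / (sqrt (real q) * cos (pi * \<sigma> / 2)) * (2 * pi / real q) powr (\<sigma> - 1))
         * (rGamma (1 - of_real \<sigma>) * mellin theta_pos (1 - of_real \<sigma>))"
    unfolding K_def[symmetric] by (simp add: sums_unique2)
qed

end

subsection \<open>Continuation and functional equation\<close>

lemma
  fixes c d :: real
  assumes "Re s > 1"
  defines "r \<equiv> \<lambda>x. indicator {0<..1} x * (c / x - d)"
  shows integrable_unit_combination: "integrable lborel (\<lambda>x. exp ((Re s - 1) * ln x) * r x)"
    and mellin_unit_combination: "mellin r s = of_real c / (s - 1) - of_real d / s"
proof -
  have inv: "indicator {0<..1} x * (1 / x) = exp (- ln x) * indicator {0<..1} x" for x :: real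
    by (auto simp: exp_minus inverse_eq_divide split: split_indicator)
  have re: "exp ((Re s - 1) * ln x) * r x
      = c * (exp ((Re (s - 1) - 1) * ln x) * indicator {0<..1} x) - d * (exp ((Re s - 1) * ln x) * indicator {0<..1} x)" for x
  proof -
    have "exp ((Re (s - 1) - 1) * ln x) = exp ((Re s - 1) * ln x) * exp (- ln x)"
      unfolding mult_exp_exp by (simp add: algebra_simps)
    then show ?thesis using inv[of x] by (simp add: r_def algebra_simps divide_inverse)
  qed
  have co: "exp ((s - 1) * of_real (ln x)) * of_real (r x)
      = of_real c * (exp ((s - 1 - 1) * of_real (ln x)) * of_real (indicator {0<..1} x))
        - of_real d * (exp ((s - 1) * of_real (ln x)) * of_real (indicator {0<..1} x))" for x
  proof -
    have E: "exp ((s - 1 - 1) * of_real (ln x)) = exp ((s - 1) * of_real (ln x)) * of_real (exp (- ln x))"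
      unfolding exp_of_real[symmetric] mult_exp_exp by (simp add: algebra_simps)
    have R: "complex_of_real (r x) = of_real c * (of_real (exp (- ln x)) * of_real (indicator {0<..1} x))
        - of_real d * of_real (indicator {0<..1} x)"
      unfolding of_real_mult[symmetric] of_real_diff[symmetric] inv[symmetric]
      by (simp add: r_def algebra_simps)
    show ?thesis unfolding E R by (simp only: right_diff_distrib mult_ac)
  qed
  have s: "Re (s - 1) > 0" "Re s > 0" using assms by simp_all
  show "integrable lborel (\<lambda>x. exp ((Re s - 1) * ln x) * r x)"
    unfolding re by (intro Bochner_Integration.integrable_diff integrable_mult_right mellin_indicator_unit s)
  have "mellin r s = of_real c * mellin (indicator {0<..1}) (s - 1) - of_real d * mellin (indicator {0<..1}) s"
  proof -
    have "integrable lborel (\<lambda>x. exp ((s - 1 - 1) * of_real (ln x)) * complex_of_real (indicator {0<..1} x))"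
      "integrable lborel (\<lambda>x. exp ((s - 1) * of_real (ln x)) * complex_of_real (indicator {0<..1} x))"
      by (intro integrable_mellin mellin_indicator_unit s; measurable)+
    then show ?thesis
      unfolding mellin_def co
      by (simp only: Bochner_Integration.integral_diff[OF integrable_mult_right integrable_mult_right]
          integral_mult_right_zero)
  qed
  then show "mellin r s = of_real c / (s - 1) - of_real d / s"
    using s by (simp add: mellin_indicator_unit(2))
qed

text \<open>The same rational function as in \<open>mellin_unit_combination\<close>: reversing the
  sign of the integrand compensates for passing from (0, 1] to the half-line above 1.\<close>

lemma has_bochner_integral_above_combination:
  fixes c d \<sigma> :: real
  assumes "\<sigma> < 0"
  shows "has_bochner_integral lborel (\<lambda>x. exp ((\<sigma> - 1) * ln x) * (indicator {1<..} x * (d - c / x)))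
           (c / (\<sigma> - 1) - d / \<sigma>)"
proof -
  have "has_bochner_integral lborel (\<lambda>x. d * (exp ((\<sigma> - 1) * ln x) * indicator {1<..} x)
     - c * (exp ((\<sigma> - 1 - 1) * ln x) * indicator {1<..} x)) (d * (- 1 / \<sigma>) - c * (- 1 / (\<sigma> - 1)))"
    using assms by (intro has_bochner_integral_diff has_bochner_integral_mult_right mellin_indicator_above) auto
  moreover have "d * (- 1 / \<sigma>) - c * (- 1 / (\<sigma> - 1)) = c / (\<sigma> - 1) - d / \<sigma>"
    by simp
  moreover have "d * (exp ((\<sigma> - 1) * ln x) * indicator {1<..} x) - c * (exp ((\<sigma> - 1 - 1) * ln x) * indicator {1<..} x)
      = exp ((\<sigma> - 1) * ln x) * (indicator {1<..} x * (d - c / x))" for x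
  proof (cases "x > 1")
    case True
    have "exp ((\<sigma> - 1 - 1) * ln x) = exp ((\<sigma> - 1) * ln x) * exp (- ln x)"
      unfolding mult_exp_exp by (simp add: algebra_simps)
    with True show ?thesis by (simp add: exp_minus algebra_simps divide_inverse)
  qed simp
  ultimately show ?thesis by (simp only:)
qed

text \<open>The factor \<open>W\<close> with 5 replaced by a general modulus q; q = 1 is the factor
  of the Riemann zeta function.\<close>

definition fe_factor :: "nat \<Rightarrow> complex \<Rightarrow> complex" where
  "fe_factor q s = of_nat q powr (1 / 2 - s) * 2 * (2 * of_real pi) powr (s - 1) * Gamma (1 - s)
      * sin (of_real pi * s / 2)"

text \<open>Identifies the constant left by the rational integral. The reflection formula expresses
  \<open>rGamma \<sigma>\<close> through sin (pi \<sigma>), and the double angle formula then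
  cancels the cosine.\<close>

lemma fe_factor_of_real:
  assumes "q > 0" "-1 < \<sigma>" "\<sigma> < 0"
  shows "fe_factor q (of_real \<sigma>) =
     rGamma (of_real \<sigma>) * of_real (pi / (sqrt (real q) * cos (pi * \<sigma> / 2)) * (2 * pi / real q) powr (\<sigma> - 1))"
proof -
  have cos: "cos (pi * \<sigma> / 2) > 0"
    using assms mult_strict_right_mono[of "-1" \<sigma> pi] by (intro cos_gt_zero_pi) (auto simp: mult.commute mult_neg_pos)
  have "1 - complex_of_real \<sigma> = of_real (1 - \<sigma>)" by simp
  then have G: "Gamma (1 - complex_of_real \<sigma>) = of_real (Gamma (1 - \<sigma>))"
    by (simp only: Gamma_complex_of_real)
  have Gpos: "Gamma (1 - \<sigma>) > 0" using assms by (intro Gamma_real_pos) simp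
  have "rGamma (of_real \<sigma>) * rGamma (1 - complex_of_real \<sigma>) = sin (of_real pi * of_real \<sigma>) / of_real pi"
    by (rule rGamma_reflection_complex)
  also have "\<dots> = of_real (sin (pi * \<sigma>) / pi)" by (simp flip: sin_of_real)
  finally have "rGamma (of_real \<sigma>) / of_real (Gamma (1 - \<sigma>)) = complex_of_real (sin (pi * \<sigma>) / pi)"
    by (simp add: rGamma_inverse_Gamma G divide_inverse)
  then have rG: "rGamma (complex_of_real \<sigma>) = of_real (sin (pi * \<sigma>) / pi * Gamma (1 - \<sigma>))"
    using Gpos by (simp add: field_simps)
  have sin2: "sin (pi * \<sigma>) = 2 * sin (pi * \<sigma> / 2) * cos (pi * \<sigma> / 2)"
    using sin_double[of "pi * \<sigma> / 2"] by simp
  have pq: "of_nat q powr (1 / 2 - complex_of_real \<sigma>) = of_real (real q powr (1 / 2 - \<sigma>))"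
    using powr_of_real[of "real q" "1 / 2 - \<sigma>"] by simp
  have p2: "(2 * of_real pi) powr (complex_of_real \<sigma> - 1) = of_real ((2 * pi) powr (\<sigma> - 1))"
    using powr_of_real[of "2 * pi" "\<sigma> - 1"] by simp
  have ps: "sin (of_real pi * of_real \<sigma> / 2) = complex_of_real (sin (pi * \<sigma> / 2))"
    by (simp flip: sin_of_real)
  have "real q powr (1 / 2 - \<sigma>) = real q powr (1 - \<sigma>) / sqrt (real q)"
    using assms by (simp add: powr_half_sqrt[symmetric] flip: powr_diff)
  moreover have "(2 * pi / real q) powr (\<sigma> - 1) = (2 * pi) powr (\<sigma> - 1) * real q powr (1 - \<sigma>)"
    using assms powr_minus[of "real q" "\<sigma> - 1"] by (simp add: powr_divide field_simps)
  ultimately have eq: "real q powr (1 / 2 - \<sigma>) * 2 * (2 * pi) powr (\<sigma> - 1) * Gamma (1 - \<sigma>) * sin (pi * \<sigma> / 2)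
     = sin (pi * \<sigma>) / pi * Gamma (1 - \<sigma>) * (pi / (sqrt (real q) * cos (pi * \<sigma> / 2)) * (2 * pi / real q) powr (\<sigma> - 1))"
    using cos by (simp add: sin2)
  have "fe_factor q (of_real \<sigma>) =
      of_real (real q powr (1 / 2 - \<sigma>) * 2 * (2 * pi) powr (\<sigma> - 1) * Gamma (1 - \<sigma>) * sin (pi * \<sigma> / 2))"
    unfolding fe_factor_def pq p2 ps G by simp
  then show ?thesis
    unfolding eq rG of_real_mult .
qed

lemma holomorphic_fe_factor:
  "q > 0 \<Longrightarrow> fe_factor q holomorphic_on {s. Re s < 1}"
  unfolding fe_factor_def
proof (intro holomorphic_intros)
  show "1 - s \<notin> \<int>\<^sub>\<le>\<^sub>0" if "s \<in> {s. Re s < 1}" for s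
  proof
    assume "1 - s \<in> \<int>\<^sub>\<le>\<^sub>0"
    then obtain n where "1 - s = of_int n" "n \<le> 0" by (elim nonpos_Ints_cases)
    then have "Re (1 - s) \<le> 0" by (metis Re_complex_of_real of_int_le_0_iff of_real_of_int_eq)
    with that show False by simp
  qed
qed auto

section \<open>Splitting at 1 and continuation to the whole plane\<close>

context self_dual_even
begin

text \<open>Near 0 the expansion without its polar terms is used, and beyond 1 (see
  \<open>high\<close>) the rapidly decaying \<open>theta\<close>. The sum of both has a Mellin
  transform for Re s > -1.\<close>

definition low :: "real \<Rightarrow> real" where "low x = indicator {0<..1} x * cauchy_pos x"
definition high :: "real \<Rightarrow> real" where "high x = indicator {1<..} x * theta_pos x"

lemma measurable_low_high [measurable]: "low \<in> borel_measurable borel" "high \<in> borel_measurable borel"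
  unfolding low_def high_def by measurable

lemma integrable_low:
  assumes "\<sigma> > -1"
  shows "integrable lborel (\<lambda>x. exp ((\<sigma> - 1) * ln x) * low x)"
proof -
  \<comment> \<open>Any exponent in (-1, 0) not above \<sigma> works, since on (0, 1] a smaller
    exponent gives a larger integrand. For \<sigma> < 0 it is the midpoint of -1 and
    \<sigma>.\<close>
  define \<tau> where "\<tau> = (if \<sigma> \<ge> 0 then -1/2 else (\<sigma> - 1) / 2)"
  have \<tau>: "-1 < \<tau>" "\<tau> < 0" "\<tau> \<le> \<sigma>" using assms by (auto simp: \<tau>_def)
  have "norm (exp ((\<sigma> - 1) * ln x) * low x) \<le> norm (exp ((\<tau> - 1) * ln x) * cauchy_pos x)" for x
  proof (cases "x \<in> {0<..1}")
    case True
    then have "(\<sigma> - 1) * ln x \<le> (\<tau> - 1) * ln x"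
      using \<tau> by (intro mult_right_mono_neg) auto
    with True show ?thesis by (simp add: low_def abs_mult mult_right_mono)
  qed (auto simp: low_def)
  then show ?thesis
    by (intro Bochner_Integration.integrable_bound[OF integrable_cauchy_pos[OF \<tau>(1,2)]]) auto
qed

lemma integrable_high: "integrable lborel (\<lambda>x. exp ((\<sigma> - 1) * ln x) * high x)"
proof -
  \<comment> \<open>Beyond 1 a larger exponent dominates; 2 guarantees the range in which
    \<open>theta_pos\<close> is integrable.\<close>
  define \<tau> where "\<tau> = max \<sigma> 2"
  have \<tau>: "\<tau> > 1" "\<tau> \<ge> \<sigma>" by (auto simp: \<tau>_def)
  have "norm (exp ((\<sigma> - 1) * ln x) * high x) \<le> norm (exp ((\<tau> - 1) * ln x) * theta_pos x)" for x
  proof (cases "x > 1")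
    case True
    then have "(\<sigma> - 1) * ln x \<le> (\<tau> - 1) * ln x"
      using \<tau> by (intro mult_right_mono) auto
    with True show ?thesis by (simp add: high_def abs_mult mult_right_mono)
  qed (auto simp: high_def)
  then show ?thesis
    using \<tau> by (intro Bochner_Integration.integrable_bound[OF integrable_theta_pos[of "of_real \<tau>"]]) auto
qed

lemma theta_pos_decomp:
  "theta_pos x = (low x + high x) + indicator {0<..1} x * (L_residue / x - a 0 / 2)"
proof (cases "x > 0")
  case True
  have "theta_pos x = 2 / sqrt (real q) * cauchy_sum x + (L_residue / x - a 0 / 2)"
    using True q_pos theta_partial_fractions[OF True]
    by (simp add: theta_pos_def L_residue_def add_divide_distrib mult_ac)
  then show ?thesis
    using True by (cases "x \<le> 1") (auto simp: low_def high_def cauchy_pos_def)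
qed (auto simp: low_def high_def theta_pos_def)

lemma cauchy_pos_decomp:
  "cauchy_pos x = (low x + high x) + indicator {1<..} x * (a 0 / 2 - L_residue / x)"
proof (cases "x > 0")
  case True
  have "theta_pos x = 2 / sqrt (real q) * cauchy_sum x + (L_residue / x - a 0 / 2)"
    using True q_pos theta_partial_fractions[OF True]
    by (simp add: theta_pos_def L_residue_def add_divide_distrib mult_ac)
  then show ?thesis
    using True by (cases "x \<le> 1") (auto simp: low_def high_def cauchy_pos_def)
qed (auto simp: low_def high_def cauchy_pos_def)

lemma integrable_low_plus_high:
  assumes "\<sigma> > -1"
  shows "integrable lborel (\<lambda>x. exp ((\<sigma> - 1) * ln x) * (low x + high x))"
  unfolding distrib_left using assms by (intro Bochner_Integration.integrable_add integrable_low integrable_high)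

lemma mellin_theta_pos:
  assumes "Re s > 1"
  shows "mellin theta_pos s = mellin (\<lambda>x. low x + high x) s + (of_real L_residue / (s - 1) - of_real (a 0 / 2) / s)"
proof -
  have "theta_pos = (\<lambda>x. (low x + high x) + indicator {0<..1} x * (L_residue / x - a 0 / 2))"
    using theta_pos_decomp by blast
  moreover have "mellin (\<lambda>x. (low x + high x) + indicator {0<..1} x * (L_residue / x - a 0 / 2)) s
     = mellin (\<lambda>x. low x + high x) s + mellin (\<lambda>x. indicator {0<..1} x * (L_residue / x - a 0 / 2)) s"
    using assms by (intro mellin_add integrable_low_plus_high integrable_unit_combination) auto
  ultimately show ?thesis
    using mellin_unit_combination[OF assms] by simp
qed

text \<open>The right-hand side is the expression of \<open>mellin_theta_pos\<close>. Hence one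
  meromorphic function is the transform of \<open>theta_pos\<close> for Re s > 1 and that of
  \<open>cauchy_pos\<close> on the segment.\<close>

lemma mellin_cauchy_pos':
  assumes "-1 < \<sigma>" "\<sigma> < 0"
  shows "mellin cauchy_pos (of_real \<sigma>) =
     mellin (\<lambda>x. low x + high x) (of_real \<sigma>) + (of_real L_residue / (of_real \<sigma> - 1) - of_real (a 0 / 2) / of_real \<sigma>)"
proof -
  have "cauchy_pos = (\<lambda>x. (low x + high x) + indicator {1<..} x * (a 0 / 2 - L_residue / x))"
    using cauchy_pos_decomp by blast
  moreover have "mellin (\<lambda>x. (low x + high x) + indicator {1<..} x * (a 0 / 2 - L_residue / x)) (of_real \<sigma>)
     = mellin (\<lambda>x. low x + high x) (of_real \<sigma>) + mellin (\<lambda>x. indicator {1<..} x * (a 0 / 2 - L_residue / x)) (of_real \<sigma>)"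
    using assms has_bochner_integral_above_combination[of \<sigma> "a 0 / 2" L_residue]
    by (intro mellin_add) (auto simp: integrable_low_plus_high has_bochner_integral_iff)
  moreover have "mellin (\<lambda>x. indicator {1<..} x * (a 0 / 2 - L_residue / x)) (of_real \<sigma>)
     = of_real (L_residue / (\<sigma> - 1) - a 0 / 2 / \<sigma>)"
    using has_bochner_integral_above_combination[OF assms(2), of "a 0 / 2" L_residue]
    unfolding mellin_of_real has_bochner_integral_iff by (simp only:)
  ultimately show ?thesis by simp
qed

text \<open>\<open>(s - 1) L(s)\<close> to the right of \<open>Re s = -1\<close>; multiplying by \<open>rGamma s = s * rGamma (s + 1)\<close>
  has already cancelled the pole of the completed function at \<open>0\<close>.\<close>
definition numer :: "complex \<Rightarrow> complex" where
  "numer s = rGamma s * ((s - 1) * mellin (\<lambda>x. low x + high x) s + of_real L_residue)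
     - of_real (a 0 / 2) * (s - 1) * rGamma (s + 1)"

lemma holomorphic_numer: "numer holomorphic_on {s. Re s > -1}"
proof -
  have "mellin (\<lambda>x. low x + high x) holomorphic_on {s. -1 < Re s \<and> Re s < \<beta>}" for \<beta>
    by (rule holomorphic_mellin) (auto intro: integrable_low_plus_high)
  \<comment> \<open>Holomorphy is known on strips with any right edge; the one ending at
    \<open>Re s + 1\<close> contains s.\<close>
  then have "mellin (\<lambda>x. low x + high x) field_differentiable at s" if "Re s > -1" for s
    using that holomorphic_on_imp_differentiable_at[of _ "{z. -1 < Re z \<and> Re z < Re s + 1}" s]
    by (simp add: open_Collect_conj open_halfspace_Re_gt open_halfspace_Re_lt)
  then have "mellin (\<lambda>x. low x + high x) holomorphic_on {s. Re s > -1}"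
    by (intro holomorphic_onI) (auto intro: field_differentiable_at_within)
  then show ?thesis
    unfolding numer_def by (intro holomorphic_intros)
qed

lemma numer_div:
  assumes "s \<noteq> 1" "s \<noteq> 0"
  shows "numer s / (s - 1) = rGamma s * (mellin (\<lambda>x. low x + high x) s
           + (of_real L_residue / (s - 1) - of_real (a 0 / 2) / s))"
proof -
  have "numer s / (s - 1) = rGamma s * (mellin (\<lambda>x. low x + high x) s + of_real L_residue / (s - 1))
      - of_real (a 0 / 2) * rGamma (s + 1)"
    using assms unfolding numer_def by (simp add: divide_simps) (simp add: algebra_simps)
  also have "of_real (a 0 / 2) * rGamma (s + 1) = rGamma s * (of_real (a 0 / 2) / s)"
    using assms rGamma_plus1[of s] by (simp add: field_simps)
  finally show ?thesis by (simp add: algebra_simps)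
qed

lemma numer_sums:
  assumes "Re s > 1"
  shows "(\<lambda>n. of_real (a (int (Suc n))) / of_nat (Suc n) powr s) sums (numer s / (s - 1))"
proof -
  have s: "s \<noteq> 1" "s \<noteq> 0" using assms by auto
  show ?thesis
    using theta_pos_sums[OF assms] unfolding numer_div[OF s] mellin_theta_pos[OF assms] .
qed

lemma numer_functional_equation_real:
  assumes "-1 < \<sigma>" "\<sigma> < 0"
  shows "numer (of_real \<sigma>) / (of_real \<sigma> - 1) = fe_factor q (of_real \<sigma>) * (numer (1 - of_real \<sigma>) / (1 - of_real \<sigma> - 1))"
proof -
  have s: "complex_of_real \<sigma> \<noteq> 1" "complex_of_real \<sigma> \<noteq> 0" "1 - complex_of_real \<sigma> \<noteq> 1" "1 - complex_of_real \<sigma> \<noteq> 0"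
    "Re (1 - complex_of_real \<sigma>) > 1"
    using assms by (auto simp: complex_eq_iff)
  show ?thesis
    unfolding numer_div[OF s(1,2)] numer_div[OF s(3,4)] mellin_theta_pos[OF s(5), symmetric]
      mellin_cauchy_pos'[OF assms, symmetric] mellin_cauchy_pos[OF assms] fe_factor_of_real[OF q_pos assms]
    by (simp only: mult_ac)
qed

text \<open>The equation on the real segment spreads to the strip by the identity theorem, because
  both sides are holomorphic there. The denominator \<open>- s\<close> is (1 - s) - 1.\<close>

lemma numer_functional_equation:
  assumes "-1 < Re s" "Re s < 0"
  shows "numer s = (s - 1) * fe_factor q s * (numer (1 - s) / (- s))"
proof -
  define S where "S = {s. -1 < Re s \<and> Re s < 0}"
  define f where "f s = numer s - (s - 1) * fe_factor q s * (numer (1 - s) / (- s))" for s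
  have "numer holomorphic_on S"
    by (rule holomorphic_on_subset[OF holomorphic_numer]) (auto simp: S_def)
  moreover have "fe_factor q holomorphic_on S"
    by (rule holomorphic_on_subset[OF holomorphic_fe_factor[OF q_pos]]) (auto simp: S_def)
  moreover have "(\<lambda>s. numer (1 - s)) holomorphic_on S"
    by (rule holomorphic_on_compose_gen[OF _ holomorphic_numer, unfolded o_def])
      (auto simp: S_def intro!: holomorphic_intros)
  ultimately have "f holomorphic_on S"
    unfolding f_def by (intro holomorphic_intros) (auto simp: S_def)
  moreover have "S = {s. -1 < Re s} \<inter> {s. Re s < 0}" by (auto simp: S_def)
  then have "open S" "connected S"
    by (auto intro!: convex_connected convex_Int open_Int simp: convex_halfspace_Re_gt convex_halfspace_Re_lt
        open_halfspace_Re_gt open_halfspace_Re_lt)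
  moreover have "f z = 0" if "z \<in> of_real ` {-1<..<0}" for z
    using that numer_functional_equation_real by (auto simp: f_def field_simps complex_eq_iff)
  moreover have "complex_of_real (-1/2) islimpt of_real ` {-1<..<0}"
  proof (rule islimpt_isCont_image)
    show "(-1/2 :: real) islimpt {-1<..<0}" by (simp add: islimpt_greaterThanLessThan1 open_imp_islimpt interior_limit_point)
    show "eventually (\<lambda>y. complex_of_real y \<noteq> complex_of_real (-1/2)) (at (-1/2))"
      using eventually_neq_at_within[of "-1/2 :: real"] by eventually_elim (simp only: of_real_eq_iff not_False_eq_True)
  qed simp
  moreover have "of_real ` {-1<..<0} \<subseteq> S" "complex_of_real (-1/2) \<in> S" "s \<in> S"
    using assms by (auto simp: S_def)
  ultimately have "f s = 0"
    by (intro analytic_continuation[of f S "of_real ` {-1<..<0}" "complex_of_real (-1/2)" s]) auto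
  then show ?thesis by (simp only: f_def right_minus_eq)
qed

text \<open>\<open>numer\<close> on Re s > -1 is glued to the function prescribed by the functional
  equation on Re s < 0; the two agree on the overlapping strip. The factor s - 1 built into
  \<open>F\<close> removes the possible pole at 1.\<close>

theorem entire_continuation:
  obtains F where "F holomorphic_on UNIV" "F 1 = of_real L_residue"
    and "\<And>s. Re s > 1 \<Longrightarrow> (\<lambda>n. of_real (a (int (Suc n))) / of_nat (Suc n) powr s) sums (F s / (s - 1))"
    and "\<And>s. Re s < 0 \<Longrightarrow> F s / (s - 1) = fe_factor q s * (F (1 - s) / (1 - s - 1))"
proof -
  define A B where "A = {s. Re s > -1}" and "B = {s. Re s < 0}"
  define F where "F s = (if s \<in> A then numer s else (s - 1) * fe_factor q s * (numer (1 - s) / (- s)))" for s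
  have "fe_factor q holomorphic_on B"
    by (rule holomorphic_on_subset[OF holomorphic_fe_factor[OF q_pos]]) (auto simp: B_def)
  moreover have "(\<lambda>s. numer (1 - s)) holomorphic_on B"
    by (rule holomorphic_on_compose_gen[OF _ holomorphic_numer, unfolded o_def])
      (auto simp: B_def intro!: holomorphic_intros)
  ultimately have "(\<lambda>s. (s - 1) * fe_factor q s * (numer (1 - s) / (- s))) holomorphic_on B"
    by (intro holomorphic_intros) (auto simp: B_def)
  then have "F holomorphic_on (A \<union> B)"
    unfolding F_def using holomorphic_numer numer_functional_equation
    by (intro holomorphic_on_If_Un) (auto simp: A_def B_def open_halfspace_Re_gt open_halfspace_Re_lt)
  moreover have "A \<union> B = UNIV" by (auto simp: A_def B_def)
  moreover have "F 1 = of_real L_residue" by (simp add: F_def A_def numer_def)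
  moreover have "(\<lambda>n. of_real (a (int (Suc n))) / of_nat (Suc n) powr s) sums (F s / (s - 1))" if "Re s > 1" for s
    using numer_sums[OF that] that by (simp add: F_def A_def)
  moreover have "F s / (s - 1) = fe_factor q s * (F (1 - s) / (1 - s - 1))" if "Re s < 0" for s
  proof -
    have "F s = (s - 1) * fe_factor q s * (numer (1 - s) / (- s))"
      using numer_functional_equation[of s] that by (auto simp: F_def A_def)
    moreover have "F (1 - s) = numer (1 - s)" "s \<noteq> 1" using that by (auto simp: F_def A_def)
    ultimately show ?thesis by simp
  qed
  ultimately show ?thesis using that by auto
qed

end

subsection \<open>The Riemann zeta function and the character modulo 5\<close>

text \<open>The identity theorem from the half-plane of convergence. It settles uniqueness in the
  definite descriptions of \<open>riemann_zeta\<close> and \<open>f1\<close>.\<close>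

lemma dirichlet_series_unique:
  fixes c :: "nat \<Rightarrow> complex"
  assumes "open S" "connected S" "{s. Re s > 1} \<subseteq> S" "f holomorphic_on S" "g holomorphic_on S"
    and "\<And>s. Re s > 1 \<Longrightarrow> (\<lambda>n. c n / of_nat (Suc n) powr s) sums f s"
    and "\<And>s. Re s > 1 \<Longrightarrow> (\<lambda>n. c n / of_nat (Suc n) powr s) sums g s"
    and "s \<in> S"
  shows "f s = g s"
proof (rule analytic_continuation_open[of "{s. Re s > 1}" S f g])
  show "{s. Re s > 1} \<noteq> {}" by (auto intro!: exI[of _ "2 :: complex"])
  show "f z = g z" if "z \<in> {s. Re s > 1}" for z
    using that assms(6,7) sums_unique2 by blast
qed (use assms in \<open>auto simp: open_halfspace_Re_gt\<close>)

text \<open>With real coefficients, conjugating argument and value leaves the series unchanged, so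
  uniqueness of the continuation applies.\<close>

lemma dirichlet_series_cnj:
  fixes c :: "nat \<Rightarrow> real"
  assumes "open S" "connected S" "{s. Re s > 1} \<subseteq> S" "cnj ` S = S" "f holomorphic_on S"
    and sums: "\<And>s. Re s > 1 \<Longrightarrow> (\<lambda>n. of_real (c n) / of_nat (Suc n) powr s) sums f s"
    and "s \<in> S"
  shows "cnj (f (cnj s)) = f s"
proof (rule dirichlet_series_unique[OF assms(1-3) _ assms(5) _ sums assms(7)])
  show "(\<lambda>s. cnj (f (cnj s))) holomorphic_on S"
    using holomorphic_on_compose_cnj_cnj[of f S] assms by (simp add: o_def)
  show "(\<lambda>n. of_real (c n) / of_nat (Suc n) powr z) sums cnj (f (cnj z))" if "Re z > 1" for z
  proof -
    have "(\<lambda>n. cnj (of_real (c n) / of_nat (Suc n) powr cnj z)) sums cnj (f (cnj z))"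
      unfolding sums_cnj using that by (intro sums) simp
    then show ?thesis by (simp add: cnj_powr)
  qed
qed

lemma connected_punctured_plane: "connected (- {1 :: complex})"
  using connected_punctured_universe[of "1 :: complex"] by simp

section \<open>The self-dual sequences modulo 1 and modulo 5\<close>

lemma self_dual_even_one: "self_dual_even 1 (\<lambda>_. 1)"
  by unfold_locales auto

text \<open>The value of the quadratic Gauss sum modulo 5.\<close>

lemma cos_fifth_difference: "2 * (cos (2 * pi / 5) - cos (4 * pi / 5)) = sqrt 5"
proof -
  define c where "c = cos (2 * pi / 5)"
  have c2: "cos (4 * pi / 5) = 2 * c\<^sup>2 - 1"
    using cos_double_cos[of "2 * pi / 5"] by (simp add: c_def)
  have c3: "cos (6 * pi / 5) = 4 * c ^ 3 - 3 * c"
    using cos_treble_cos[of "2 * pi / 5"] by (simp add: c_def)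
  have "cos (6 * pi / 5) = cos (4 * pi / 5)"
    using cos_2pi_minus[of "4 * pi / 5"] by simp
  \<comment> \<open>Double and triple angle formulas turn cos (6 pi / 5) = cos (4 pi / 5) into a
    cubic in c. Below, c < 1 excludes the root 1 and c > 0 selects the positive square root.\<close>
  then have "(c - 1) * (4 * c\<^sup>2 + 2 * c - 1) = 0"
    unfolding c2 c3 by (simp add: algebra_simps power2_eq_square power3_eq_cube)
  moreover have "c > 0" unfolding c_def by (intro cos_gt_zero) auto
  moreover have "c < 1" unfolding c_def using cos_monotone_0_pi[of 0 "2 * pi / 5"] by simp
  ultimately have q: "4 * c\<^sup>2 + 2 * c - 1 = 0" by simp
  then have "(4 * c + 1)\<^sup>2 = 5" by (simp add: power2_eq_square algebra_simps)
  with \<open>c > 0\<close> have "4 * c + 1 = sqrt 5" by (intro real_sqrt_unique[symmetric]) auto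
  with q show ?thesis unfolding c2 c_def[symmetric] by simp
qed

definition chi5_int :: "int \<Rightarrow> real" where
  "chi5_int j = (if j mod 5 \<in> {1, 4} then 1 else if j mod 5 \<in> {2, 3} then - 1 else 0)"

lemma chi5_eq: "chi5 n = of_real (chi5_int (int n))"
proof -
  have "int n mod 5 = int (n mod 5)" by (simp add: zmod_int)
  then show ?thesis by (auto simp: chi5_def chi5_int_def)
qed

text \<open>The cosines depend only on the index modulo 5 and take two values besides 1. The
  transform is therefore checked on each residue of n, where the Gauss sum supplies
  \<open>sqrt 5\<close>.\<close>

lemma self_dual_even_chi5: "self_dual_even 5 chi5_int"
proof
  show "chi5_int (j + int 5) = chi5_int j" for j by (simp add: chi5_int_def)
  show "chi5_int (- j) = chi5_int j" for j
  proof -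
    have "j mod 5 = 0 \<or> j mod 5 = 1 \<or> j mod 5 = 2 \<or> j mod 5 = 3 \<or> j mod 5 = 4" by presburger
    moreover have "(- j) mod 5 = (5 - j mod 5) mod 5" by presburger
    ultimately show ?thesis by (auto simp: chi5_int_def)
  qed
  define C where "C k = cos (2 * pi * real k / 5)" for k :: nat
  have C_mod: "C k = C (k mod 5)" for k
  proof -
    have arg: "2 * pi * real k / 5 = 2 * pi * real (k mod 5) / 5 + 2 * pi * real (k div 5)"
    proof -
      have "real k = real (5 * (k div 5) + k mod 5)" by (simp only: mult_div_mod_eq)
      also have "\<dots> = 5 * real (k div 5) + real (k mod 5)" by (simp only: of_nat_add of_nat_mult of_nat_numeral)
      finally have "2 * pi * real k / 5 = 2 * pi * (5 * real (k div 5) + real (k mod 5)) / 5" by (simp only:)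
      then show ?thesis by (simp add: field_simps)
    qed
    have "cos (2 * pi * real (k div 5)) = 1" "sin (2 * pi * real (k div 5)) = 0"
      using cos_2npi[of "k div 5"] sin_2npi[of "k div 5"] by (simp_all add: mult_ac)
    then show ?thesis unfolding C_def arg cos_add by simp
  qed
  have C: "C 4 = C 1" "C 3 = C 2" "2 * C 1 - 2 * C 2 = sqrt 5"
    using cos_2pi_minus[of "2 * pi / 5"] cos_2pi_minus[of "4 * pi / 5"] cos_fifth_difference
    by (simp_all add: C_def)
  show "(\<Sum>k<5. chi5_int (int k) * cos (2 * pi * real k * real n / real 5)) = sqrt (real 5) * chi5_int (int n)" for n
  proof -
    have Ck: "cos (2 * pi * real k * real n / 5) = C ((k * (n mod 5)) mod 5)" for k
      using C_mod[of "k * n"] by (simp add: C_def mult.assoc mod_mult_right_eq)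
    have "{..<5 :: nat} = {0, 1, 2, 3, 4}" by auto
    moreover have "chi5_int (int 0) = 0" "chi5_int (int 1) = 1" "chi5_int (int 2) = -1"
      "chi5_int (int 3) = -1" "chi5_int (int 4) = 1"
      by (simp_all add: chi5_int_def)
    ultimately have sum: "(\<Sum>k<5. chi5_int (int k) * cos (2 * pi * real k * real n / 5))
       = C (1 * (n mod 5) mod 5) - C (2 * (n mod 5) mod 5) - C (3 * (n mod 5) mod 5) + C (4 * (n mod 5) mod 5)"
      unfolding Ck by simp
    have chi: "chi5_int (int n) = chi5_int (int (n mod 5))" by (simp add: chi5_int_def zmod_int)
    consider "n mod 5 = 0" | "n mod 5 = 1" | "n mod 5 = 2" | "n mod 5 = 3" | "n mod 5 = 4" by linarith
    then have "(\<Sum>k<5. chi5_int (int k) * cos (2 * pi * real k * real n / 5)) = sqrt 5 * chi5_int (int n)"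
      unfolding sum chi using C by cases (simp_all add: chi5_int_def)
    then show ?thesis by simp
  qed
qed simp

section \<open>Properties of zeta, \<open>f1\<close> and \<open>f0\<close>\<close>

lemma W_eq_fe_factor: "W s = fe_factor 5 s"
  by (simp add: W_def fe_factor_def)

lemma fe_factor_5: "fe_factor 5 s = 5 powr (1 / 2 - s) * fe_factor 1 s"
  by (simp add: fe_factor_def)

lemma zeta_entire_numerator:
  obtains F where "F holomorphic_on UNIV" "riemann_zeta = (\<lambda>s. F s / (s - 1))"
    "\<And>s. cnj (riemann_zeta (cnj s)) = riemann_zeta s"
    "\<And>s. Re s < 0 \<Longrightarrow> riemann_zeta s = fe_factor 1 s * riemann_zeta (1 - s)"
proof -
  interpret self_dual_even 1 "\<lambda>_. 1" by (rule self_dual_even_one)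
  obtain F where F: "F holomorphic_on UNIV"
    "\<And>s. Re s > 1 \<Longrightarrow> (\<lambda>n. of_real 1 / of_nat (Suc n) powr s) sums (F s / (s - 1))"
    "\<And>s. Re s < 0 \<Longrightarrow> F s / (s - 1) = fe_factor 1 s * (F (1 - s) / (1 - s - 1))"
    by (rule entire_continuation) auto
  have hol: "(\<lambda>s. F s / (s - 1)) holomorphic_on - {1}"
    by (intro holomorphic_intros holomorphic_on_subset[OF F(1)]) auto
  have half: "{s. Re s > 1} \<subseteq> - {1}" by auto
  have zeta: "riemann_zeta = (\<lambda>s. F s / (s - 1))"
    unfolding riemann_zeta_def
  proof (rule the_equality)
    \<comment> \<open>Division by zero yields 0, which matches the value prescribed for
      \<open>riemann_zeta\<close> at the pole.\<close>
    show "(\<lambda>s. F s / (s - 1)) holomorphic_on - {1} \<and> F 1 / (1 - 1) = 0 \<and>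
      (\<forall>s. Re s > 1 \<longrightarrow> (\<lambda>n. 1 / of_nat (Suc n) powr s) sums (F s / (s - 1)))"
      using F(2) hol by simp
    fix g assume g: "g holomorphic_on - {1} \<and> g 1 = 0 \<and>
      (\<forall>s. Re s > 1 \<longrightarrow> (\<lambda>n. 1 / of_nat (Suc n) powr s) sums g s)"
    show "g = (\<lambda>s. F s / (s - 1))"
    proof
      fix s
      show "g s = F s / (s - 1)"
      proof (cases "s = 1")
        case False
        then show ?thesis
          using g F(2) hol
          by (intro dirichlet_series_unique[of "- {1}" g "\<lambda>s. F s / (s - 1)" "\<lambda>_. 1" s] half connected_punctured_plane) auto
      qed (use g in simp)
    qed
  qed
  have zeta_cnj: "cnj (riemann_zeta (cnj s)) = riemann_zeta s" for s
  proof (cases "s = 1")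
    case False
    have "cnj ` (- {1}) = - {1}"
      by (simp add: bij_image_Compl_eq involuntory_imp_bij)
    with False show ?thesis
      unfolding zeta using hol F(2)
      by (intro dirichlet_series_cnj[of "- {1}" "\<lambda>s. F s / (s - 1)" "\<lambda>_. 1" s] half connected_punctured_plane) auto
  qed (simp add: zeta)
  have "riemann_zeta s = fe_factor 1 s * riemann_zeta (1 - s)" if "Re s < 0" for s
    unfolding zeta by (rule F(3)[OF that])
  then show ?thesis by (rule that[OF F(1) zeta zeta_cnj])
qed

lemma f1_properties:
  shows "f1 holomorphic_on UNIV" "\<And>s. cnj (f1 (cnj s)) = f1 s"
    "\<And>s. Re s < 0 \<Longrightarrow> f1 s = fe_factor 5 s * f1 (1 - s)"
proof -
  interpret self_dual_even 5 chi5_int by (rule self_dual_even_chi5)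
  obtain F where F: "F holomorphic_on UNIV" "F 1 = of_real L_residue"
    "\<And>s. Re s > 1 \<Longrightarrow> (\<lambda>n. of_real (chi5_int (int (Suc n))) / of_nat (Suc n) powr s) sums (F s / (s - 1))"
    "\<And>s. Re s < 0 \<Longrightarrow> F s / (s - 1) = fe_factor 5 s * (F (1 - s) / (1 - s - 1))"
    by (rule entire_continuation) auto
  \<comment> \<open>The residue vanishes because the character is 0 at 0, so the singularity at 1 is
    removable; \<open>E\<close> fills it with the derivative of \<open>F\<close>.\<close>
  have F1: "F 1 = 0" by (simp add: F(2) L_residue_def chi5_int_def)
  define E where "E s = (if s = 1 then deriv F 1 else F s / (s - 1))" for s
  have hol: "E holomorphic_on UNIV"
    unfolding E_def[abs_def] using pole_lemma_open[OF F(1) open_UNIV, of 1, unfolded F1 diff_zero] .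
  have sums: "(\<lambda>n. of_real (chi5_int (int (Suc n))) / of_nat (Suc n) powr s) sums E s" if "Re s > 1" for s
    using F(3)[OF that] that by (auto simp: E_def)
  have f1: "f1 = E"
    unfolding f1_def
  proof (rule the_equality)
    show "E holomorphic_on UNIV \<and> (\<forall>s. Re s > 1 \<longrightarrow> (\<lambda>n. chi5 (Suc n) / of_nat (Suc n) powr s) sums E s)"
      using sums hol by (simp add: chi5_eq)
    fix g assume g: "g holomorphic_on UNIV \<and> (\<forall>s. Re s > 1 \<longrightarrow> (\<lambda>n. chi5 (Suc n) / of_nat (Suc n) powr s) sums g s)"
    show "g = E"
    proof
      fix s
      show "g s = E s"
        using g sums hol
        by (intro dirichlet_series_unique[of UNIV g E "\<lambda>n. chi5 (Suc n)" s]) (auto simp: chi5_eq)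
    qed
  qed
  show "f1 holomorphic_on UNIV" using hol by (simp add: f1)
  have "surj cnj" by (metis complex_cnj_cnj surjI)
  then show "cnj (f1 (cnj s)) = f1 s" for s
    unfolding f1 using hol sums
    by (intro dirichlet_series_cnj[of UNIV E "\<lambda>n. chi5_int (int (Suc n))" s]) auto
  show "f1 s = fe_factor 5 s * f1 (1 - s)" if "Re s < 0" for s
    using F(4)[OF that] that by (auto simp: f1 E_def)
qed

lemma f0_properties:
  shows "f0 meromorphic_on UNIV" "f0 holomorphic_on - {1}" "\<And>s. cnj (f0 (cnj s)) = f0 s"
    "\<And>s. Re s < 0 \<Longrightarrow> f0 s = fe_factor 5 s * f0 (1 - s)"
proof -
  obtain F where F: "F holomorphic_on UNIV" "riemann_zeta = (\<lambda>s. F s / (s - 1))"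
    "\<And>s. cnj (riemann_zeta (cnj s)) = riemann_zeta s"
    "\<And>s. Re s < 0 \<Longrightarrow> riemann_zeta s = fe_factor 1 s * riemann_zeta (1 - s)"
    by (rule zeta_entire_numerator) blast
  have euler: "(\<lambda>s. 1 + of_real (sqrt 5) / 5 powr s :: complex) holomorphic_on A" for A
    by (intro holomorphic_intros) auto
  have f0: "f0 = (\<lambda>s. (1 + of_real (sqrt 5) / 5 powr s) * (F s / (s - 1)))"
    by (simp add: f0_def[abs_def] F(2))
  have "(\<lambda>s. 1 + of_real (sqrt 5) / 5 powr s :: complex) meromorphic_on UNIV" "F meromorphic_on UNIV"
    using euler[of UNIV] F(1) by (auto intro!: analytic_on_imp_meromorphic_on simp: analytic_on_open)
  then show "f0 meromorphic_on UNIV"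
    unfolding f0
    by (rule meromorphic_on_mult[OF _ meromorphic_on_divide[OF _ meromorphic_on_diff[OF meromorphic_on_id meromorphic_on_const]]])
  show "f0 holomorphic_on - {1}"
    unfolding f0 by (intro holomorphic_on_mult euler holomorphic_intros holomorphic_on_subset[OF F(1)]) auto
  show "cnj (f0 (cnj s)) = f0 s" for s
    by (simp add: f0_def F(3) cnj_powr)
  show "f0 s = fe_factor 5 s * f0 (1 - s)" if "Re s < 0" for s
  proof -
    have half: "complex_of_real (sqrt 5) = 5 powr (1 / 2)"
      using powr_of_real[of 5 "1/2"] by (simp add: powr_half_sqrt)
    \<comment> \<open>The factor e(s) = 1 + 5^(1/2 - s) satisfies e(s) = 5^(1/2 - s) e(1 - s),
      because 5^(1/2 - s) and 5^(s - 1/2) are inverse. This supplies exactly the quotient of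
      \<open>fe_factor 5\<close> and \<open>fe_factor 1\<close>.\<close>
    have euler_eq: "5 powr (1 / 2 - s) * (1 + 5 powr (1 / 2) / 5 powr (1 - s)) = 1 + 5 powr (1 / 2) / (5 :: complex) powr s"
    proof -
      have "5 powr (1 / 2 - s) * (5 powr (1 / 2) / 5 powr (1 - s)) = (5 :: complex) powr ((1 / 2 - s) + (1 / 2 - (1 - s)))"
        by (simp only: powr_add powr_diff[of 5 "1/2" "1 - s"])
      then show ?thesis by (simp add: distrib_left powr_diff)
    qed
    show ?thesis
      unfolding f0_def half F(4)[OF that] fe_factor_5 euler_eq[symmetric] by (simp only: mult_ac)
  qed
qed

section \<open>The exceptional points, the common functional equation and the deformation\<close>

lemma sparse_Nats: "(\<nat> :: complex set) sparse_in A"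
proof -
  have "\<not> x islimpt (\<nat> :: complex set)" for x
  proof (rule discrete_imp_not_islimpt[of 1])
    fix x y :: complex assume "x \<in> \<nat>" "y \<in> \<nat>" and d: "dist y x < 1"
    then obtain m n where mn: "x = of_nat m" "y = of_nat n" by (auto elim!: Nats_cases)
    have "dist y x = \<bar>real n - real m\<bar>"
      unfolding mn dist_norm by (metis norm_of_real of_real_diff of_real_of_nat_eq)
    with d show "y = x" unfolding mn by simp
  qed simp
  then show ?thesis using sparse_in_open[OF open_UNIV] sparse_in_subset by blast
qed

theorem theorem1:
  shows "(\<forall>\<tau>\<in>{0..1}.
            phi \<tau> meromorphic_on UNIV \<and>
            (\<lambda>s. W s * cnj (phi \<tau> (1 - cnj s))) meromorphic_on UNIV \<and>
            (\<forall>\<^sub>\<approx>s\<in>UNIV. phi \<tau> s = W s * cnj (phi \<tau> (1 - cnj s))))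
       \<and> phi 0 = f0 \<and> phi 1 = f1
       \<and> (\<forall>K. compact K \<and> K \<subseteq> - {1} \<longrightarrow>
            (\<forall>\<tau>'\<in>{0..1}. uniform_limit K phi (phi \<tau>') (at \<tau>' within {0..1})))"
proof (intro conjI ballI allI impI)
  fix \<tau> :: real
  have phi_alt: "phi \<tau> = (\<lambda>s. of_real (1 - \<tau>) * f0 s + of_real \<tau> * f1 s)"
    by (simp add: phi_def[abs_def])
  have f1_mero: "f1 meromorphic_on UNIV"
    using f1_properties(1) by (auto intro!: analytic_on_imp_meromorphic_on simp: analytic_on_open)
  show mero: "phi \<tau> meromorphic_on UNIV"
    unfolding phi_alt by (intro meromorphic_intros f0_properties f1_mero)
  have hol: "phi \<tau> holomorphic_on - {1}"
    unfolding phi_alt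
    by (intro holomorphic_intros f0_properties holomorphic_on_subset[OF f1_properties(1)]) auto
  \<comment> \<open>Both \<open>f0\<close> and \<open>f1\<close> commute with conjugation and \<tau>
    is real, so the conjugations cancel.\<close>
  have refl: "cnj (phi \<tau> (1 - cnj s)) = phi \<tau> (1 - s)" for s
    using f0_properties(3)[of "1 - s"] f1_properties(2)[of "1 - s"] by (simp add: phi_def)
  \<comment> \<open>The Gamma factor is meromorphic as the inverse of an entire function.\<close>
  have G_mero: "(\<lambda>s :: complex. inverse (rGamma (1 - s))) meromorphic_on UNIV"
    by (intro meromorphic_on_inverse analytic_on_imp_meromorphic_on)
      (auto simp: analytic_on_open intro!: holomorphic_intros)
  have "(\<lambda>s :: complex. 5 powr (1 / 2 - s) * 2 * (2 * of_real pi) powr (s - 1)) meromorphic_on UNIV"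
     "(\<lambda>s :: complex. sin (of_real pi * s / 2)) meromorphic_on UNIV"
    by (auto intro!: analytic_on_imp_meromorphic_on holomorphic_intros simp: analytic_on_open)
  then have W_mero: "W meromorphic_on UNIV"
    unfolding W_def[abs_def] Gamma_def by (rule meromorphic_on_mult[OF meromorphic_on_mult[OF _ G_mero]])
  have "(\<lambda>s. phi \<tau> (1 - s)) meromorphic_on UNIV"
    by (rule meromorphic_on_compose[OF mero]) (auto intro!: analytic_intros)
  then show "(\<lambda>s. W s * cnj (phi \<tau> (1 - cnj s))) meromorphic_on UNIV"
    unfolding refl by (intro meromorphic_intros W_mero)
  \<comment> \<open>The natural numbers contain all possible poles: 1 from
    \<open>phi \<tau> s\<close>, 0 from \<open>phi \<tau> (1 - s)\<close>, and the positive integers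
    from \<open>Gamma (1 - s)\<close>. Their complement is connected, so the equation extends from
    Re s < 0, where it is linear in \<open>f0\<close> and \<open>f1\<close>.\<close>
  have fe: "phi \<tau> s = W s * phi \<tau> (1 - s)" if s: "s \<notin> \<nat>" for s
  proof (rule analytic_continuation_open[of "{s. Re s < 0}" "- \<nat>" "phi \<tau>"])
    show "open (- (\<nat> :: complex set))" "connected (- (\<nat> :: complex set))"
      using open_diff_sparse_pts[OF open_UNIV sparse_Nats] sparse_imp_connected[OF _ connected_UNIV open_UNIV sparse_Nats]
      by (simp_all add: Compl_eq_Diff_UNIV)
    show "{s. Re s < 0} \<noteq> {}" by (auto intro!: exI[of _ "-1 :: complex"])
    show "{s. Re s < 0} \<subseteq> - \<nat>" by (auto elim!: Nats_cases)
    show "phi \<tau> holomorphic_on - \<nat>"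
      by (rule holomorphic_on_subset[OF hol]) auto
    have "(\<lambda>s. phi \<tau> (1 - s)) holomorphic_on - \<nat>"
      by (rule holomorphic_on_compose_gen[OF _ hol, unfolded o_def]) (auto intro!: holomorphic_intros)
    moreover have "1 - z \<notin> \<int>\<^sub>\<le>\<^sub>0" if "z \<in> - \<nat>" for z :: complex
    proof
      assume "1 - z \<in> \<int>\<^sub>\<le>\<^sub>0"
      then obtain n where "1 - z = - of_nat n" by (elim nonpos_Ints_cases')
      then have "z = of_nat (Suc n)" by (simp add: algebra_simps)
      with that show False by (simp del: of_nat_Suc)
    qed
    then have "W holomorphic_on - \<nat>"
      unfolding W_def[abs_def] by (intro holomorphic_intros) auto
    ultimately show "(\<lambda>s. W s * phi \<tau> (1 - s)) holomorphic_on - \<nat>"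
      by (intro holomorphic_intros)
    show "phi \<tau> z = W z * phi \<tau> (1 - z)" if "z \<in> {s. Re s < 0}" for z
      using that f0_properties(4)[of z] f1_properties(3)[of z]
      by (simp add: phi_def W_eq_fe_factor algebra_simps)
  qed (use s in \<open>auto simp: open_halfspace_Re_lt\<close>)
  show "\<forall>\<^sub>\<approx>s\<in>UNIV. phi \<tau> s = W s * cnj (phi \<tau> (1 - cnj s))"
    unfolding refl using eventually_not_in_cosparse[OF sparse_Nats] by eventually_elim (rule fe)
next
  show "phi 0 = f0" "phi 1 = f1" by (simp_all add: phi_def[abs_def])
next
  fix K :: "complex set" and \<tau>' :: real
  assume K: "compact K \<and> K \<subseteq> - {1}"
  \<comment> \<open>The difference of two members of the family is (\<tau> - \<tau>') (f1 - f0), so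
    a bound for \<open>f1 - f0\<close> on K gives the uniform limit.\<close>
  have "continuous_on K (\<lambda>s. f1 s - f0 s)"
    using K by (intro continuous_intros holomorphic_on_imp_continuous_on
        holomorphic_on_subset[OF f0_properties(2)] holomorphic_on_subset[OF f1_properties(1)]) auto
  then have "bounded ((\<lambda>s. f1 s - f0 s) ` K)"
    using K by (intro compact_imp_bounded compact_continuous_image) auto
  then obtain M where M: "M > 0" "\<And>s. s \<in> K \<Longrightarrow> norm (f1 s - f0 s) \<le> M"
    by (auto simp: bounded_pos)
  show "uniform_limit K phi (phi \<tau>') (at \<tau>' within {0..1})"
  proof (rule uniform_limitI)
    fix e :: real assume "e > 0"
    then have "eventually (\<lambda>\<tau>. dist \<tau> \<tau>' < e / M) (at \<tau>' within {0..1})"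
      using M tendsto_ident_at[of \<tau>' "{0..1}"] by (auto intro!: tendstoD)
    then show "\<forall>\<^sub>F \<tau> in at \<tau>' within {0..1}. \<forall>s\<in>K. dist (phi \<tau> s) (phi \<tau>' s) < e"
    proof eventually_elim
      case (elim \<tau>)
      show ?case
      proof
        fix s assume "s \<in> K"
        have "phi \<tau> s - phi \<tau>' s = of_real (\<tau> - \<tau>') * (f1 s - f0 s)"
          by (simp add: phi_def algebra_simps)
        then have "dist (phi \<tau> s) (phi \<tau>' s) = \<bar>\<tau> - \<tau>'\<bar> * norm (f1 s - f0 s)"
          by (simp only: dist_norm norm_mult norm_of_real)
        also have "\<dots> \<le> \<bar>\<tau> - \<tau>'\<bar> * M" using M(2)[OF \<open>s \<in> K\<close>] by (intro mult_left_mono) auto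
        also have "\<dots> < e" using elim M(1) by (simp add: dist_real_def field_simps)
        finally show "dist (phi \<tau> s) (phi \<tau>' s) < e" .
      qed
    qed
  qed
qed

end
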